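(* Let $k$ be a field and let $\Delta$ be an unsuspended $(d-1)$-dimensional homology sphere (over $k$) on $n$ vertices with $m$ minimal non-faces, such that $n-d=3$. Then $m$ is odd, $n=m\ge 5$, and $\Delta$ is (isomorphic to) the boundary complex of the cyclic $d$-polytope $C_d(n)$ with $n$ vertices.
   Context: A simplicial complex $\Delta$ on $n$ vertices is a family of subsets (faces) of a vertex set identified with $[n]=\{1,\dots,n\}$, closed under taking subsets, containing $\emptyset$ and all singletons $\{i\}$, $i\in[n]$. A minimal non-face of $\Delta$ is a set $M\subset[n]$ with $M\notin\Delta$ but $M\setminus\{i\}\in\Delta$ for every $i\in M$. A homology sphere (over $k$) is a $(d-1)$-dimensional simplicial complex, $d\ge 1$, such that for every face $F$ (including $F=\emptyset$) the link $\{S : S\cap F=\emptyset,\ S\cup F\in\Delta\}$ has the same reduced homology over $k$ as a sphere of dimension $d-1-|F|$. For a vertex $v$, $lk_\Delta(v)=\{S\in\Delta : v\notin S,\ S\cup\{v\}\in\Delta\}$. The one-point suspension of $\Delta$ at $v$ is $\Sigma_{1,v}\Delta=\{S,\ S\cup\{v\},\ S\cup\{v'\} : v\notin S\in\Delta\}\cup\{S\cup\{v,v'\} : S\in lk_\Delta(v)\}$, where $v'$ is a new vertex. The two-point suspension is $\Sigma_2\Delta=\{S,\ S\cup\{w\},\ S\cup\{w'\} : S\in\Delta\}$, where $w,w'$ are two new vertices. A simplicial complex is unsuspended if it cannot be obtained from another complex by an iterated application of operations $\Sigma_{1,v}$ and $\Sigma_2$. *)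

theory Defs
  imports "HOL-Analysis.Analysis" "HOL-Library.Function_Algebras"
begin

section \<open>Finite abstract simplicial complexes\<close>

text \<open>Every element of the vertex set is required to be a face, so \<open>V = \<Union>\<Delta>\<close>; the
  definitions below recover the vertex set of a complex in this way.\<close>

definition complex_on :: "'a set \<Rightarrow> 'a set set \<Rightarrow> bool" where
  "complex_on V \<Delta> \<longleftrightarrow> finite V \<and> \<Delta> \<subseteq> Pow V \<and> {} \<in> \<Delta> \<and> (\<forall>v\<in>V. {v} \<in> \<Delta>) \<and>
     (\<forall>S\<in>\<Delta>. \<forall>T. T \<subseteq> S \<longrightarrow> T \<in> \<Delta>)"

definition complex_dim :: "'a set set \<Rightarrow> int" where
  "complex_dim \<Delta> = int (Max (card ` \<Delta>)) - 1"

definition minimal_nonfaces :: "'a set set \<Rightarrow> 'a set set" where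
  "minimal_nonfaces \<Delta> = {M. M \<subseteq> \<Union>\<Delta> \<and> M \<notin> \<Delta> \<and> (\<forall>i\<in>M. M - {i} \<in> \<Delta>)}"

definition face_link :: "'a set set \<Rightarrow> 'a set \<Rightarrow> 'a set set" where
  "face_link \<Delta> F = {S. S \<inter> F = {} \<and> S \<union> F \<in> \<Delta>}"

definition complex_iso :: "'a set set \<Rightarrow> 'b set set \<Rightarrow> bool" where
  "complex_iso \<Delta> \<Gamma> \<longleftrightarrow> (\<exists>f. bij_betw f (\<Union>\<Delta>) (\<Union>\<Gamma>) \<and> (\<lambda>S. f ` S) ` \<Delta> = \<Gamma>)"

lemma complex_on_finite: "complex_on V \<Delta> \<Longrightarrow> finite V"
  by (simp add: complex_on_def)

lemma complex_on_face_subset: "complex_on V \<Delta> \<Longrightarrow> S \<in> \<Delta> \<Longrightarrow> S \<subseteq> V"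
  unfolding complex_on_def by (meson PowD subsetD)

lemma complex_on_closed: "complex_on V \<Delta> \<Longrightarrow> S \<in> \<Delta> \<Longrightarrow> T \<subseteq> S \<Longrightarrow> T \<in> \<Delta>"
  unfolding complex_on_def by meson

lemma complex_on_Union:
  assumes "complex_on V \<Delta>"
  shows "\<Union>\<Delta> = V"
proof
  show "\<Union>\<Delta> \<subseteq> V"
    using complex_on_face_subset[OF assms] by (rule Union_least)
  show "V \<subseteq> \<Union>\<Delta>"
  proof
    fix v assume "v \<in> V"
    then have "{v} \<in> \<Delta>" using assms by (simp add: complex_on_def)
    then show "v \<in> \<Union>\<Delta>" by (rule UnionI) simp
  qed
qed


section \<open>Reduced simplicial homology with coefficients in a field\<close>

text \<open>A chain is a function from sets of vertices to coefficients; an \<open>i\<close>-chain is supported on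
  the \<open>i\<close>-dimensional faces. The empty face has dimension \<open>-1\<close> and is not left out, so that
  the chain complex is the augmented one. The pointwise vector space structure comes from
  \<^theory>\<open>HOL-Library.Function_Algebras\<close>.\<close>

definition chain_scale :: "'k::field \<Rightarrow> ('a set \<Rightarrow> 'k) \<Rightarrow> 'a set \<Rightarrow> 'k" where
  "chain_scale a c = (\<lambda>S. a * c S)"

lemma vector_space_chain_scale: "vector_space (chain_scale :: 'k::field \<Rightarrow> ('a set \<Rightarrow> 'k) \<Rightarrow> _)"
  by unfold_locales (auto simp: chain_scale_def fun_eq_iff algebra_simps)

definition face_chains :: "'a set set \<Rightarrow> int \<Rightarrow> ('a set \<Rightarrow> 'k::field) set" where
  "face_chains \<Delta> i = {c. \<forall>S. c S \<noteq> 0 \<longrightarrow> S \<in> \<Delta> \<and> int (card S) = i + 1}"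

text \<open>The usual differential
  \<open>\<partial>[v\<^sub>0,\<dots>,v\<^sub>i] = (\<Sum>j. (-1)^j [v\<^sub>0,\<dots>,v\<^sub>j\<^sub>-\<^sub>1,v\<^sub>j\<^sub>+\<^sub>1,\<dots>,v\<^sub>i])\<close> for \<open>v\<^sub>0 < \<dots> < v\<^sub>i\<close>,
  written out as the coefficient of \<open>\<partial>c\<close> at \<open>T\<close>: the faces having \<open>T\<close> in their boundary are the
  \<open>insert v T\<close>, and \<open>v\<close> is preceded in \<open>insert v T\<close> by the \<open>u \<in> T\<close> with \<open>u < v\<close>.\<close>

definition differential :: "'a::linorder set set \<Rightarrow> ('a set \<Rightarrow> 'k::field) \<Rightarrow> 'a set \<Rightarrow> 'k" where
  "differential \<Delta> c = (\<lambda>T. \<Sum>v | v \<notin> T \<and> insert v T \<in> \<Delta>. (-1) ^ card {u\<in>T. u < v} * c (insert v T))"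

definition cycles :: "'a::linorder set set \<Rightarrow> int \<Rightarrow> ('a set \<Rightarrow> 'k::field) set" where
  "cycles \<Delta> i = {c \<in> face_chains \<Delta> i. differential \<Delta> c = 0}"

definition boundaries :: "'a::linorder set set \<Rightarrow> int \<Rightarrow> ('a set \<Rightarrow> 'k::field) set" where
  "boundaries \<Delta> i = differential \<Delta> ` face_chains \<Delta> (i + 1)"

text \<open>The dimension over \<open>'k\<close> of the \<open>i\<close>-th reduced homology space \<open>cycles / boundaries\<close>; all
  spaces are finite-dimensional for a finite complex, and the natural-number subtraction does not
  truncate since boundaries are cycles (\<open>boundaries_subset_cycles\<close> below).\<close>

definition reduced_homology_dim :: "'k::field itself \<Rightarrow> 'a::linorder set set \<Rightarrow> int \<Rightarrow> nat" where
  "reduced_homology_dim _ \<Delta> i =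
     vector_space.dim chain_scale (cycles \<Delta> i :: ('a set \<Rightarrow> 'k) set) -
     vector_space.dim chain_scale (boundaries \<Delta> i :: ('a set \<Rightarrow> 'k) set)"

lemma finite_insert_faces:
  assumes "complex_on V \<Delta>"
  shows "finite {v. v \<notin> T \<and> insert v T \<in> \<Delta>}"
  by (rule finite_subset[OF _ complex_on_finite[OF assms]])
     (auto dest: complex_on_face_subset[OF assms])

lemma differential_differential:
  fixes c :: "'a::linorder set \<Rightarrow> 'k::field"
  assumes \<Delta>: "complex_on V \<Delta>"
  shows "differential \<Delta> (differential \<Delta> c) = 0"
proof
  fix T
  define s where "s v A = (-1::'k) ^ card {u\<in>A. u < v}" for v :: 'a and A
  define A where "A = {v. v \<notin> T \<and> insert v T \<in> \<Delta>}"
  define B where "B v = {u. u \<notin> insert v T \<and> insert u (insert v T) \<in> \<Delta>}" for v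
  define P where "P = Sigma A B"
  define g where "g v u = s v T * s u (insert v T) * c (insert u (insert v T))" for v u
  have fin: "finite A" "finite (B v)" for v
    unfolding A_def B_def by (rule finite_insert_faces[OF \<Delta>])+
  have P_iff: "(v, u) \<in> P \<longleftrightarrow> v \<notin> T \<and> u \<notin> T \<and> u \<noteq> v \<and> insert u (insert v T) \<in> \<Delta>" for v u
  proof -
    have "insert u (insert v T) \<in> \<Delta> \<Longrightarrow> insert v T \<in> \<Delta>"
      using complex_on_closed[OF \<Delta> _ subset_insertI] .
    then show ?thesis
      unfolding P_def A_def B_def by blast
  qed
  have P_swap: "(u, v) \<in> P" if "(v, u) \<in> P" for u v
    using that unfolding P_iff by (metis insert_commute)
  have finP: "finite P"
    unfolding P_def using fin by blast
  have g_swap: "g v u = - g u v" if "(v, u) \<in> P" "u < v" for u v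
  proof -
    have p: "v \<notin> T" "u \<notin> T" "insert u (insert v T) \<in> \<Delta>"
      using that by (simp_all add: P_iff)
    have "T \<subseteq> V"
      using complex_on_face_subset[OF \<Delta> p(3)] by simp
    then have T: "finite T"
      using complex_on_finite[OF \<Delta>] by (rule finite_subset)
    have "{w \<in> insert v T. w < u} = {w \<in> T. w < u}"
      using \<open>u < v\<close> by auto
    then have "s u (insert v T) = s u T"
      by (simp add: s_def)
    moreover have "{w \<in> insert u T. w < v} = insert u {w \<in> T. w < v}"
      using \<open>u < v\<close> by auto
    then have "s v (insert u T) = - s v T"
      using p T by (simp add: s_def)
    ultimately show ?thesis
      by (simp add: g_def insert_commute[of u v])
  qed
  have "differential \<Delta> (differential \<Delta> c) T = (\<Sum>v\<in>A. \<Sum>u\<in>B v. g v u)"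
    unfolding differential_def A_def B_def s_def g_def sum_distrib_left mult.assoc ..
  also have "\<dots> = (\<Sum>(v, u)\<in>P. g v u)"
    unfolding P_def by (rule sum.Sigma) (use fin in blast)+
  also have "P = {(v, u) \<in> P. v < u} \<union> {(v, u) \<in> P. u < v}"
    by (auto simp: P_iff)
  also have "(\<Sum>(v, u)\<in>\<dots>. g v u) =
      (\<Sum>(v, u) | (v, u) \<in> P \<and> v < u. g v u) + (\<Sum>(v, u) | (v, u) \<in> P \<and> u < v. g v u)"
    by (rule sum.union_disjoint) (auto intro: finite_subset[OF _ finP])
  also have "(\<Sum>(v, u) | (v, u) \<in> P \<and> u < v. g v u) = (\<Sum>(v, u) | (v, u) \<in> P \<and> v < u. - g v u)"
    by (rule sum.reindex_bij_witness[of _ prod.swap prod.swap]) (auto dest: P_swap g_swap)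
  finally show "differential \<Delta> (differential \<Delta> c) T = 0 T"
    by (simp add: sum_negf split_def)
qed

lemma boundaries_subset_cycles:
  assumes \<Delta>: "complex_on V \<Delta>"
  shows "boundaries \<Delta> i \<subseteq> (cycles \<Delta> i :: ('a::linorder set \<Rightarrow> 'k::field) set)"
proof
  fix b :: "'a set \<Rightarrow> 'k" assume "b \<in> boundaries \<Delta> i"
  then obtain c where c: "c \<in> face_chains \<Delta> (i + 1)" and b: "b = differential \<Delta> c"
    by (auto simp: boundaries_def)
  have "b \<in> face_chains \<Delta> i"
    unfolding face_chains_def
  proof (intro CollectI allI impI)
    fix T assume "b T \<noteq> 0"
    then obtain v where v: "v \<notin> T" "insert v T \<in> \<Delta>" "c (insert v T) \<noteq> 0"
      unfolding b differential_def by (auto elim!: sum.not_neutral_contains_not_neutral)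
    have "T \<subseteq> V"
      using complex_on_face_subset[OF \<Delta> v(2)] by simp
    then have "finite T"
      using complex_on_finite[OF \<Delta>] by (rule finite_subset)
    moreover have "int (card (insert v T)) = i + 2"
      using c v by (auto simp: face_chains_def)
    moreover have "T \<in> \<Delta>"
      using \<Delta> v(2) subset_insertI by (rule complex_on_closed)
    ultimately show "T \<in> \<Delta> \<and> int (card T) = i + 1"
      using v(1) by simp
  qed
  then show "b \<in> cycles \<Delta> i"
    by (simp add: cycles_def b differential_differential[OF \<Delta>])
qed

text \<open>An \<open>e\<close>-dimensional sphere (\<open>e \<ge> -1\<close>) has reduced homology \<open>'k\<close> in degree \<open>e\<close> and
  \<open>0\<close> in all other degrees.\<close>

definition homology_sphere :: "'k::field itself \<Rightarrow> nat \<Rightarrow> 'a::linorder set \<Rightarrow> 'a set set \<Rightarrow> bool" where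
  "homology_sphere k d V \<Delta> \<longleftrightarrow> complex_on V \<Delta> \<and> d \<ge> 1 \<and> complex_dim \<Delta> = int d - 1 \<and>
     (\<forall>F\<in>\<Delta>. \<forall>i. reduced_homology_dim k (face_link \<Delta> F) i =
        (if i = int d - 1 - int (card F) then 1 else 0))"


section \<open>Suspensions\<close>

definition one_point_suspension :: "'a \<Rightarrow> 'a \<Rightarrow> 'a set set \<Rightarrow> 'a set set" where
  "one_point_suspension v v' \<Delta> =
     (\<Union>S\<in>{S\<in>\<Delta>. v \<notin> S}. {S, S \<union> {v}, S \<union> {v'}}) \<union> {S \<union> {v, v'} | S. S \<in> face_link \<Delta> {v}}"

definition two_point_suspension :: "'a \<Rightarrow> 'a \<Rightarrow> 'a set set \<Rightarrow> 'a set set" where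
  "two_point_suspension w w' \<Delta> = (\<Union>S\<in>\<Delta>. {S, S \<union> {w}, S \<union> {w'}})"

inductive suspension_step :: "'a set set \<Rightarrow> 'a set set \<Rightarrow> bool" where
  one_point: "v \<in> \<Union>\<Delta> \<Longrightarrow> v' \<notin> \<Union>\<Delta> \<Longrightarrow> suspension_step \<Delta> (one_point_suspension v v' \<Delta>)"
| two_point: "w \<notin> \<Union>\<Delta> \<Longrightarrow> w' \<notin> \<Union>\<Delta> \<Longrightarrow> w \<noteq> w' \<Longrightarrow>
    suspension_step \<Delta> (two_point_suspension w w' \<Delta>)"

text \<open>At least one operation must be applied; complexes are considered up to isomorphism. Since a
  suspension adds vertices, nothing is lost by taking the vertices of the other complex in the same
  type.\<close>

definition unsuspended :: "'a set set \<Rightarrow> bool" where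
  "unsuspended \<Delta> \<longleftrightarrow> \<not> (\<exists>V \<Gamma> \<Gamma>'. complex_on (V :: 'a set) \<Gamma> \<and>
     suspension_step\<^sup>+\<^sup>+ \<Gamma> \<Gamma>' \<and> complex_iso \<Gamma>' \<Delta>)"


section \<open>Cyclic polytopes\<close>

text \<open>The linear order on the index type only serves to number the coordinates as \<open>1,\<dots>,d\<close>:
  \<open>card {..j}\<close> is the position of \<open>j\<close>, and \<open>moment_curve t = (t, t\<^sup>2, \<dots>, t\<^sup>d)\<close>. The numeral
  types provide such index types of every cardinality \<open>d \<ge> 1\<close>.\<close>

definition moment_curve :: "real \<Rightarrow> real ^ 'd::{finite,linorder}" where
  "moment_curve t = (\<chi> j. t ^ card {..j})"

text \<open>The cyclic polytope with \<open>n\<close> vertices at the parameters \<open>t 1 < \<dots> < t n\<close>.\<close>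

definition cyclic_polytope :: "nat \<Rightarrow> (nat \<Rightarrow> real) \<Rightarrow> (real ^ 'd::{finite,linorder}) set" where
  "cyclic_polytope n t = convex hull ((\<lambda>i. moment_curve (t i)) ` {1..n})"

text \<open>The boundary complex of a simplicial polytope, as an abstract complex on its vertices: the
  faces are the vertex sets of the proper faces of the polytope (including the empty one).\<close>

definition boundary_complex :: "'v::real_vector set \<Rightarrow> 'v set set" where
  "boundary_complex P = {{x. x extreme_point_of F} | F. F face_of P \<and> F \<noteq> P}"

end

(*
  The complements of the facets form a set T of triples. Vanishing of the lower homology makes the
  complex pure, and the links of the ridges, being 0-spheres, show that every 4-set of vertices
  contains 0 or 2 triples of T. For a fixed vertex x, T is therefore determined by the graph on the
  other vertices whose edges are the pairs forming a triple with x; this graph has no triangle and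
  no induced pair of disjoint edges. An induced pentagon would exhibit the six-vertex projective
  plane as a link, which is impossible over any field. The neighbours of a vertex of maximal degree
  then split the graph into two independent sides with nested neighbourhoods. Two vertices that are
  interchangeable with respect to T exhibit the complex as a suspension, so in an unsuspended complex there are no isolated
  vertices and all neighbourhoods on one side are distinct: the graph is a half graph, T is unique up
  to isomorphism, and it consists of the triples of {1..n}, n odd, with alternating parities. By
  Gale's evenness condition these are the complements of the facets of the cyclic polytope. That the
  cyclic polytope has no further faces is seen from the vanishing divided difference of a
  supporting polynomial times a suitable linear one.
*)

theory Submission
  imports Defs "HOL-Computational_Algebra.Polynomial"
begin

section \<open>Purity and ridges of homology spheres\<close>

text \<open>Because \<open>n - d = 3\<close>, passing to complements replaces faces of arbitrary
  dimension by triples. A set of triples with an even number in every 4-set is a two-graph, and a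
  two-graph is recovered from its graph at any single vertex; this is why one vertex
  \<open>x\<close> is fixed. That 4-sets with all four triples are excluded too is what forbids
  induced pairs of disjoint edges. The ridge condition alone is too weak: the six-vertex projective
  plane satisfies it. Excluding that complex is the only place where links other than those of
  facets and ridges are used. Parity enters through the half graph: listed by degree in opposite
  directions, its two sides interleave into one line, one side taking the odd and the other the even
  numbers, with \<open>x\<close> last. The equality \<open>m = n\<close> comes from a second
  description of the triples, as the cyclic triangles of a tournament. The complement of a non-face
  is then a transitive subtournament, and the minimal non-faces are the out-neighbourhoods, one for
  each vertex.\<close>

interpretation chain: vector_space "chain_scale :: 'k::field \<Rightarrow> ('a set \<Rightarrow> 'k) \<Rightarrow> _"
  by (rule vector_space_chain_scale)

lemma chain_dim_zero: "chain.dim {0 :: 'a set \<Rightarrow> 'k::field} = 0"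
  by (metis chain.dim_eq_card_independent chain.dim_span chain.span_empty chain.independent_empty card.empty)

lemma differential_zero: "differential \<Delta> 0 = 0"
  by (simp add: differential_def fun_eq_iff)

lemma face_chains_trivial:
  assumes "\<And>S. S \<in> \<Delta> \<Longrightarrow> int (card S) \<noteq> i + 1"
  shows "face_chains \<Delta> i = {0 :: 'a set \<Rightarrow> 'k::field}"
  using assms by (fastforce simp: face_chains_def fun_eq_iff)

lemma zero_in_cycles: "0 \<in> cycles \<Delta> i"
  by (simp add: cycles_def face_chains_def differential_zero)

text \<open>\<open>reduced_homology_dim\<close> is a truncated difference of dimensions, so
  exactness needs an argument: a basis of the boundaries extends to one of the cycles, and comparing
  finite cardinalities makes the two bases equal. \<open>E\<close> supplies the finiteness, as the
  space of all functions on sets may be infinite-dimensional.\<close>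

lemma homology_zero_exact:
  fixes \<Delta> :: "'a::linorder set set"
  assumes \<Delta>: "complex_on V \<Delta>" and h: "reduced_homology_dim TYPE('k::field) \<Delta> i = 0"
    and c: "c \<in> (cycles \<Delta> i :: ('a set \<Rightarrow> 'k) set)"
  shows "c \<in> boundaries \<Delta> i"
proof -
  let ?Z = "cycles \<Delta> i :: ('a set \<Rightarrow> 'k) set" and ?B = "boundaries \<Delta> i :: ('a set \<Rightarrow> 'k) set"
  have fin: "finite \<Delta>"
    using \<Delta> by (meson complex_on_def finite_Pow_iff finite_subset)
  define E where "E = (\<lambda>S X. if X = S then 1 else 0 :: 'k) ` \<Delta>"
  have finE: "finite E" using fin by (simp add: E_def)
  have span: "?Z \<subseteq> chain.span E"
  proof
    fix z assume "z \<in> ?Z"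
    then have z: "z S \<noteq> 0 \<Longrightarrow> S \<in> \<Delta>" for S
      by (auto simp: cycles_def face_chains_def)
    have app: "(\<Sum>S\<in>D. g S) X = (\<Sum>S\<in>D. g S X)" for D X and g :: "'a set \<Rightarrow> 'a set \<Rightarrow> 'k"
      by (induction D rule: infinite_finite_induct) auto
    have "z X = (\<Sum>S\<in>\<Delta>. chain_scale (z S) (\<lambda>X. if X = S then 1 else 0)) X" for X
      using z[of X] fin by (auto simp: app chain_scale_def if_distrib[of "times _"] cong: if_cong)
    then have "z = (\<Sum>S\<in>\<Delta>. chain_scale (z S) (\<lambda>X. if X = S then 1 else 0))" ..
    also have "\<dots> \<in> chain.span E"
      by (intro chain.span_sum chain.span_scale chain.span_base) (auto simp: E_def)
    finally show "z \<in> chain.span E" .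
  qed
  have sub: "?B \<subseteq> ?Z" by (rule boundaries_subset_cycles[OF \<Delta>])
  obtain B where B: "B \<subseteq> ?B" "chain.independent B" "?B \<subseteq> chain.span B" "card B = chain.dim ?B"
    using chain.basis_exists by blast
  obtain C where C: "B \<subseteq> C" "C \<subseteq> ?Z" "chain.independent C" "?Z \<subseteq> chain.span C"
    using chain.maximal_independent_subset_extend[of B ?Z] B sub by blast
  have finC: "finite C"
    using chain.independent_span_bound[OF finE C(3)] C(2) span by blast
  have "card C = chain.dim ?Z"
    using chain.basis_card_eq_dim[OF C(2,4,3)] by simp
  moreover have "chain.dim ?Z \<le> chain.dim ?B"
    using h by (simp add: reduced_homology_dim_def)
  ultimately have "B = C"
    using card_seteq[OF finC C(1)] B(4) by simp
  then have "c \<in> chain.span ?B"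
    using C(4) c chain.span_mono[OF B(1)] by blast
  moreover have "chain.subspace ?B"
    unfolding chain.subspace_def boundaries_def
  proof (intro conjI ballI allI)
    show "0 \<in> differential \<Delta> ` face_chains \<Delta> (i + 1)"
      by (rule image_eqI[of _ _ 0]) (auto simp: differential_zero face_chains_def)
  next
    fix x y :: "'a set \<Rightarrow> 'k" assume "x \<in> differential \<Delta> ` face_chains \<Delta> (i + 1)" "y \<in> differential \<Delta> ` face_chains \<Delta> (i + 1)"
    then obtain a b where ab: "x = differential \<Delta> a" "y = differential \<Delta> b"
      "a \<in> face_chains \<Delta> (i + 1)" "b \<in> face_chains \<Delta> (i + 1)" by blast
    have "x + y = differential \<Delta> (a + b)"
      by (simp add: ab(1,2) differential_def fun_eq_iff sum.distrib distrib_left)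
    moreover have "a + b \<in> face_chains \<Delta> (i + 1)"
      using ab(3,4) unfolding face_chains_def by simp (metis add.left_neutral)
    ultimately show "x + y \<in> differential \<Delta> ` face_chains \<Delta> (i + 1)" by blast
  next
    fix r :: 'k and x :: "'a set \<Rightarrow> 'k" assume "x \<in> differential \<Delta> ` face_chains \<Delta> (i + 1)"
    then obtain a where a: "x = differential \<Delta> a" "a \<in> face_chains \<Delta> (i + 1)" by blast
    have "chain_scale r x = differential \<Delta> (chain_scale r a)"
      by (simp add: a(1) differential_def fun_eq_iff chain_scale_def sum_distrib_left mult.left_commute)
    moreover have "chain_scale r a \<in> face_chains \<Delta> (i + 1)"
      using a(2) by (auto simp: face_chains_def chain_scale_def)
    ultimately show "chain_scale r x \<in> differential \<Delta> ` face_chains \<Delta> (i + 1)" by blast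
  qed
  ultimately show ?thesis
    by (simp add: chain.span_eq_iff[THEN iffD2])
qed

lemma complex_on_link:
  assumes "complex_on V \<Delta>" "F \<in> \<Delta>"
  shows "complex_on (\<Union>(face_link \<Delta> F)) (face_link \<Delta> F)"
proof -
  have "face_link \<Delta> F \<subseteq> Pow V"
    using complex_on_face_subset[OF assms(1)] by (auto simp: face_link_def)
  then have "finite (\<Union>(face_link \<Delta> F))"
    using complex_on_finite[OF assms(1)] by (meson Sup_le_iff PowD finite_subset subsetD)
  moreover have down: "\<And>S U. S \<in> face_link \<Delta> F \<Longrightarrow> U \<subseteq> S \<Longrightarrow> U \<in> face_link \<Delta> F"
    using complex_on_closed[OF assms(1)] unfolding face_link_def
    by (metis (mono_tags, lifting) Int_mono Un_mono mem_Collect_eq order_refl subset_empty)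
  moreover have "{} \<in> face_link \<Delta> F" using assms(2) by (simp add: face_link_def)
  moreover have "\<forall>v\<in>\<Union>(face_link \<Delta> F). {v} \<in> face_link \<Delta> F" using down by blast
  ultimately show ?thesis unfolding complex_on_def by blast
qed

section \<open>Facets and ridges of a homology sphere\<close>

context
  fixes d :: nat and V :: "'a::linorder set" and \<Delta>
  assumes sphere: "homology_sphere TYPE('k::field) d V \<Delta>"
begin

lemma sphere_complex: "complex_on V \<Delta>" and sphere_dim_pos: "d \<ge> 1"
  using sphere by (auto simp: homology_sphere_def)

lemma sphere_link:
  "F \<in> \<Delta> \<Longrightarrow> reduced_homology_dim TYPE('k) (face_link \<Delta> F) i = (if i = int d - 1 - int (card F) then 1 else 0)"
  using sphere by (auto simp: homology_sphere_def)

lemma sphere_faces_finite: "finite \<Delta>" "F \<in> \<Delta> \<Longrightarrow> finite F"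
  using sphere_complex unfolding complex_on_def
  by (meson finite_Pow_iff finite_subset, meson PowD finite_subset subsetD)

lemma sphere_card_le: "F \<in> \<Delta> \<Longrightarrow> card F \<le> d"
proof -
  assume F: "F \<in> \<Delta>"
  have "Max (card ` \<Delta>) = d" using sphere by (simp add: homology_sphere_def complex_dim_def)
  then show ?thesis using Max_ge[of "card ` \<Delta>" "card F"] sphere_faces_finite(1) F by auto
qed

text \<open>A maximal face has the link \<open>{{}}\<close>, whose homology sits in degree -1,
  whereas the sphere condition asks for homology in degree \<open>d - 1 - card F'\<close>. This
  forces \<open>card F' = d\<close>.\<close>

lemma sphere_pure:
  assumes F: "F \<in> \<Delta>"
  obtains F' where "F' \<in> \<Delta>" "F \<subseteq> F'" "card F' = d"
proof -
  obtain F' where F': "F \<subseteq> F'" "F' \<in> \<Delta>" and max: "\<And>H. H \<in> \<Delta> \<Longrightarrow> F' \<subseteq> H \<Longrightarrow> H = F'"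
    using finite_has_maximal2[OF sphere_faces_finite(1) F] by metis
  have "face_link \<Delta> F' = {{}}"
    using max F' unfolding face_link_def by (auto; blast)
  moreover have "card F' = d"
  proof (rule ccontr)
    assume "card F' \<noteq> d"
    then have lt: "card F' < d" using sphere_card_le[OF F'(2)] by simp
    define i where "i = int d - 1 - int (card F')"
    have "face_chains {{}} i = {0 :: 'a set \<Rightarrow> 'k}"
      by (rule face_chains_trivial) (use lt in \<open>auto simp: i_def\<close>)
    then have "cycles {{}} i = {0 :: 'a set \<Rightarrow> 'k}"
      using zero_in_cycles[of "{{}}" i] unfolding cycles_def by blast
    moreover have "reduced_homology_dim TYPE('k) {{} :: 'a set} i = 1"
      using sphere_link[OF F'(2), of i] \<open>face_link \<Delta> F' = {{}}\<close> by (simp add: i_def)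
    ultimately show False by (simp add: reduced_homology_dim_def chain_dim_zero)
  qed
  ultimately show ?thesis using that F' by blast
qed

text \<open>The link of \<open>F\<close> consists of isolated points. As the chain complex is
  augmented, its 0-cycles have dimension one less than the number of points, so dimension 1 means
  two points.\<close>

lemma sphere_ridge:
  assumes F: "F \<in> \<Delta>" and cF: "card F = d - 1"
  obtains a b where "a \<noteq> b" "{v. v \<notin> F \<and> insert v F \<in> \<Delta>} = {a, b}"
proof -
  let ?L = "face_link \<Delta> F"
  let ?P = "{v. v \<notin> F \<and> insert v F \<in> \<Delta>}"
  have L: "S = {} \<or> (\<exists>v\<in>?P. S = {v})" if "S \<in> ?L" for S
  proof -
    have S: "S \<inter> F = {}" "S \<union> F \<in> \<Delta>" using that by (auto simp: face_link_def)
    then have "card S + card F \<le> d"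
      using sphere_card_le[OF S(2)] sphere_faces_finite(2)[OF S(2)] by (simp add: card_Un_disjoint)
    then have "card S \<le> 1" using cF sphere_dim_pos by simp
    moreover have "finite S" using sphere_faces_finite(2)[OF S(2)] by simp
    ultimately show ?thesis
      using S by (metis (mono_tags, lifting) card_0_eq card_1_singletonE insert_disjoint(1) insert_is_Un le_Suc_eq le_zero_eq mem_Collect_eq One_nat_def)
  qed
  have Psingle: "{v} \<in> ?L" if "v \<in> ?P" for v
    using that by (auto simp: face_link_def)
  have finP: "finite ?P" by (rule finite_insert_faces[OF sphere_complex])
  have diff: "differential ?L c = (\<lambda>T. if T = {} then \<Sum>v\<in>?P. c {v} else 0)" for c :: "'a set \<Rightarrow> 'k"
  proof
    fix T
    show "differential ?L c T = (if T = {} then \<Sum>v\<in>?P. c {v} else 0)"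
    proof (cases "T = {}")
      case True
      have "{v. v \<notin> {} \<and> insert v {} \<in> ?L} = ?P" using Psingle by (auto dest: L)
      then show ?thesis unfolding differential_def True by (simp only: if_True) simp
    next
      case False
      have "insert v T \<notin> ?L" if "v \<notin> T" for v
        using L[of "insert v T"] that subset_singletonD[of T] False
        by (metis insert_not_empty insertI1 singletonD subset_insertI)
      then have "{v. v \<notin> T \<and> insert v T \<in> ?L} = {}" by blast
      then show ?thesis unfolding differential_def using False by (simp only: if_False sum.empty)
    qed
  qed
  have "face_chains ?L (0 + 1) = {0 :: 'a set \<Rightarrow> 'k}"
    by (rule face_chains_trivial) (use L in fastforce)
  then have "boundaries ?L 0 = {0 :: 'a set \<Rightarrow> 'k}"
    by (simp add: boundaries_def differential_zero)
  moreover have "reduced_homology_dim TYPE('k) ?L 0 = 1"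
    using sphere_link[OF F, of 0] cF sphere_dim_pos by simp
  ultimately have dim1: "chain.dim (cycles ?L 0 :: ('a set \<Rightarrow> 'k) set) = 1"
    by (simp add: reduced_homology_dim_def chain_dim_zero)
  have chainsI: "c \<in> cycles ?L 0" if "\<And>S. c S \<noteq> 0 \<Longrightarrow> \<exists>v\<in>?P. S = {v}" "(\<Sum>v\<in>?P. c {v}) = 0"
    for c :: "'a set \<Rightarrow> 'k"
    using that Psingle unfolding cycles_def face_chains_def diff by (fastforce simp: fun_eq_iff)
  obtain B :: "('a set \<Rightarrow> 'k) set" where B: "cycles ?L 0 \<subseteq> chain.span B" "card B = 1"
    using chain.basis_exists[of "cycles ?L 0"] dim1 by metis
  from B(2) obtain b where "B = {b}" by (rule card_1_singletonE)
  with B(1) have "cycles ?L 0 \<subseteq> chain.span {b}" by simp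
  then have span: "\<exists>r. c = chain_scale r b" if "c \<in> cycles ?L 0" for c
    using that unfolding chain.span_singleton by blast
  \<comment> \<open>The difference of two points, the basic 0-cycle of the augmented
    complex.\<close>
  define e where "e u v S = (if S = {u} then 1 else if S = {v} then -1 else 0 :: 'k)" for u v and S :: "'a set"
  have e: "e u v \<in> cycles ?L 0" if "u \<in> ?P" "v \<in> ?P" "u \<noteq> v" for u v
  proof (rule chainsI)
    show "\<exists>w\<in>?P. S = {w}" if "e u v S \<noteq> 0" for S
      using that \<open>u \<in> ?P\<close> \<open>v \<in> ?P\<close> by (auto simp: e_def split: if_splits)
    have "(\<Sum>w\<in>?P. e u v {w}) = (\<Sum>w\<in>{u, v}. e u v {w})"
      by (rule sum.mono_neutral_right) (use that finP in \<open>auto simp: e_def\<close>)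
    then show "(\<Sum>w\<in>?P. e u v {w}) = 0" using that by (simp add: e_def)
  qed
  obtain F' where F': "F' \<in> \<Delta>" "F \<subseteq> F'" "card F' = d" using sphere_pure[OF F] .
  then have "card (F' - F) = 1"
    using cF sphere_dim_pos sphere_faces_finite(2)[OF F] by (simp add: card_Diff_subset)
  then obtain u where "F' - F = {u}" by (rule card_1_singletonE)
  then have "insert u F = F'" "u \<notin> F" using F'(2) by blast+
  then have u: "u \<in> ?P" using F'(1) by simp
  \<comment> \<open>A single point carries no nonzero 0-cycle, because the coefficients of a cycle
    sum to 0.\<close>
  have "\<exists>v\<in>?P. v \<noteq> u"
  proof (rule ccontr)
    assume "\<not> ?thesis"
    then have Pu: "?P = {u}" using u by auto
    have "cycles ?L 0 = {0 :: 'a set \<Rightarrow> 'k}"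
    proof -
      have "c = 0" if c: "c \<in> cycles ?L 0" for c :: "'a set \<Rightarrow> 'k"
      proof
        fix S
        have "c {u} = 0" using c unfolding cycles_def diff Pu by (auto simp: fun_eq_iff split: if_splits)
        moreover have "c S \<noteq> 0 \<Longrightarrow> S = {u}"
          using c L[of S] Pu by (auto simp: cycles_def face_chains_def)
        ultimately show "c S = 0 S" by auto
      qed
      then show ?thesis using zero_in_cycles[of ?L 0] by blast
    qed
    then show False using dim1 by (simp add: chain_dim_zero)
  qed
  then obtain v where v: "v \<in> ?P" "v \<noteq> u" by blast
  \<comment> \<open>With a third point, \<open>e u v\<close> and \<open>e u w\<close> would be
    independent cycles in the space spanned by \<open>b\<close>.\<close>
  have "w = u \<or> w = v" if w: "w \<in> ?P" for w
  proof (rule ccontr)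
    assume ne: "\<not> ?thesis"
    obtain r where r: "e u v = chain_scale r b" using span[OF e[OF u v(1) v(2)[symmetric]]] ..
    have "u \<noteq> w" using ne by blast
    then obtain s where s: "e u w = chain_scale s b" using span[OF e[OF u w]] by blast
    have "s * e u v {v} = r * e u w {v}" "s * e u v {u} = r * e u w {u}"
      unfolding r s chain_scale_def by (simp_all add: algebra_simps)
    then have "s = 0" using v(2) ne by (auto simp: e_def)
    then have "e u w {u} = 0" unfolding s chain_scale_def by simp
    then show False by (simp add: e_def)
  qed
  then have "?P = {u, v}" using u v by blast
  with v(2) that show ?thesis by metis
qed

end


section \<open>Complements of facets\<close>

definition cofacets :: "'a set \<Rightarrow> 'a set set \<Rightarrow> 'a set set" where
  "cofacets V \<Delta> = {t. t \<subseteq> V \<and> card t = 3 \<and> V - t \<in> \<Delta>}"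

section \<open>Signs of oriented triples\<close>

definition order_sign :: "'a::linorder \<Rightarrow> 'a \<Rightarrow> 'k::field" where
  "order_sign u v = (if u < v then 1 else - 1)"

text \<open>Chains live on sets and take their signs from the order of the vertices.
  \<open>oriented c\<close> is the corresponding alternating function of ordered triples, so that
  cycle equations keep their shape under every relabelling of the vertices.\<close>

definition oriented :: "('a::linorder set \<Rightarrow> 'k::field) \<Rightarrow> 'a \<Rightarrow> 'a \<Rightarrow> 'a \<Rightarrow> 'k" where
  "oriented c u v w = order_sign u v * order_sign u w * order_sign v w * c {u, v, w}"

lemma order_sign_swap: "u \<noteq> v \<Longrightarrow> order_sign v u = - order_sign u v"
  by (auto simp: order_sign_def)

lemma order_sign_neq_0: "order_sign u v \<noteq> 0"
  by (simp add: order_sign_def)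

lemma oriented_swap:
  assumes "u \<noteq> v" "u \<noteq> w" "v \<noteq> w"
  shows "oriented c v u w = - oriented c u v w" "oriented c u w v = - oriented c u v w"
  using assms by (simp_all add: oriented_def order_sign_swap[of u v] order_sign_swap[of v w] insert_commute)

lemma oriented_eq_0_iff: "oriented c u v w = 0 \<longleftrightarrow> c {u, v, w} = 0"
  by (simp add: oriented_def order_sign_neq_0)

text \<open>The number of vertices of an edge below \<open>w\<close> has the parity recorded by the
  product of the two order signs. What remains is one global sign of the edge.\<close>

lemma differential_edge:
  fixes c :: "'a::linorder set \<Rightarrow> 'k::field"
  assumes W: "finite W" "L \<subseteq> Pow W" and c: "\<And>S. c S \<noteq> 0 \<Longrightarrow> S \<in> L" and "u \<noteq> v"
  shows "differential L c {u, v} = order_sign u v * (\<Sum>w\<in>W - {u, v}. oriented c u v w)"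
proof -
  have sgn: "(-1) ^ card {z\<in>{u, v}. z < w} = (order_sign u w * order_sign v w :: 'k)" if "w \<notin> {u, v}" for w
  proof -
    have "{z\<in>{u, v}. z < w} = (if u < w then {u} else {}) \<union> (if v < w then {v} else {})" by auto
    then show ?thesis using \<open>u \<noteq> v\<close> by (auto simp: order_sign_def)
  qed
  have sq: "order_sign u v * (order_sign u v * x) = x" for x :: 'k
    by (simp add: order_sign_def)
  have "differential L c {u, v} = (\<Sum>w | w \<notin> {u, v} \<and> insert w {u, v} \<in> L. order_sign u v * oriented c u v w)"
    unfolding differential_def oriented_def
  proof (rule sum.cong[OF refl])
    fix w assume "w \<in> {w. w \<notin> {u, v} \<and> insert w {u, v} \<in> L}"
    then show "(- 1) ^ card {z\<in>{u, v}. z < w} * c (insert w {u, v}) =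
      order_sign u v * (order_sign u v * order_sign u w * order_sign v w * c {u, v, w})"
      by (subst sgn) (auto simp: sq mult.assoc insert_commute)
  qed
  also have "\<dots> = (\<Sum>w\<in>W - {u, v}. order_sign u v * oriented c u v w)"
    using W c by (intro sum.mono_neutral_left) (auto simp: oriented_eq_0_iff insert_commute)
  finally show ?thesis by (simp add: sum_distrib_left)
qed

lemma differential_mono:
  assumes "finite W" "L \<subseteq> M" "M \<subseteq> Pow W" and c: "\<And>S. c S \<noteq> 0 \<Longrightarrow> S \<in> L"
  shows "differential L c = differential M c"
proof
  fix S
  have "{v. v \<notin> S \<and> insert v S \<in> M} \<subseteq> W" using assms(3) by blast
  then have "finite {v. v \<notin> S \<and> insert v S \<in> M}" using assms(1) finite_subset by blast
  then show "differential L c S = differential M c S"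
    unfolding differential_def using assms(2) c by (intro sum.mono_neutral_left) auto
qed

context
  fixes d :: nat and V :: "'a::linorder set" and \<Delta>
  assumes sphere: "homology_sphere TYPE('k::field) d V \<Delta>" and card_V: "card V = d + 3"
begin

lemma sphere_vertices: "finite V" "F \<in> \<Delta> \<Longrightarrow> F \<subseteq> V" "F \<in> \<Delta> \<Longrightarrow> H \<subseteq> F \<Longrightarrow> H \<in> \<Delta>"
  using complex_on_finite[OF sphere_complex[OF sphere]] complex_on_face_subset[OF sphere_complex[OF sphere]]
    complex_on_closed[OF sphere_complex[OF sphere]] by auto

text \<open>By purity the facets, and therefore their complements, determine the complex.\<close>

lemma sphere_face_iff: "S \<in> \<Delta> \<longleftrightarrow> S \<subseteq> V \<and> (\<exists>t\<in>cofacets V \<Delta>. t \<inter> S = {})"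
proof
  assume S: "S \<in> \<Delta>"
  obtain F where F: "F \<in> \<Delta>" "S \<subseteq> F" "card F = d" using sphere_pure[OF sphere S] .
  have "F \<subseteq> V" using F(1) by (rule sphere_vertices(2))
  then have "V - (V - F) = F" "card (V - F) = 3"
    using F(3) card_V by (auto simp: card_Diff_subset finite_subset[OF _ sphere_vertices(1)])
  then have "V - F \<in> cofacets V \<Delta>" using F(1) by (simp add: cofacets_def)
  then show "S \<subseteq> V \<and> (\<exists>t\<in>cofacets V \<Delta>. t \<inter> S = {})" using F(2) \<open>F \<subseteq> V\<close> by blast
next
  assume "S \<subseteq> V \<and> (\<exists>t\<in>cofacets V \<Delta>. t \<inter> S = {})"
  then obtain t where "S \<subseteq> V - t" "V - t \<in> \<Delta>" by (auto simp: cofacets_def)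
  then show "S \<in> \<Delta>" using sphere_vertices(3) by blast
qed

text \<open>The ridge \<open>V - {a, b, c, e}\<close> lies in exactly two facets. One arises by
  adding \<open>e\<close> and has the complement \<open>{a, b, c}\<close>; the other arises by
  adding exactly one of \<open>a\<close>, \<open>b\<close>, \<open>c\<close>.\<close>

lemma cofacet_exchange:
  assumes t: "{a, b, c} \<in> cofacets V \<Delta>" and e: "e \<in> V" "e \<notin> {a, b, c}"
  shows "{b, c, e} \<in> cofacets V \<Delta> \<and> {a, c, e} \<notin> cofacets V \<Delta> \<and> {a, b, e} \<notin> cofacets V \<Delta> \<or>
    {b, c, e} \<notin> cofacets V \<Delta> \<and> {a, c, e} \<in> cofacets V \<Delta> \<and> {a, b, e} \<notin> cofacets V \<Delta> \<or>
    {b, c, e} \<notin> cofacets V \<Delta> \<and> {a, c, e} \<notin> cofacets V \<Delta> \<and> {a, b, e} \<in> cofacets V \<Delta>"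
proof -
  let ?R = "V - {a, b, c, e}"
  have V: "a \<in> V" "b \<in> V" "c \<in> V" and c3: "card {a, b, c} = 3" and tD: "V - {a, b, c} \<in> \<Delta>"
    using t by (auto simp: cofacets_def)
  have ne: "a \<noteq> b" "a \<noteq> c" "b \<noteq> c"
    using c3 by (auto simp: card_insert_if split: if_splits)
  have R: "?R \<in> \<Delta>" using tD by (rule sphere_vertices(3)) blast
  have "card {a, b, c, e} = 4" using ne e(2) by auto
  then have "card ?R = d - 1"
    using V e card_V by (subst card_Diff_subset) auto
  from sphere_ridge[OF sphere R this]
  obtain p q where pq: "p \<noteq> q" "{v. v \<notin> ?R \<and> insert v ?R \<in> \<Delta>} = {p, q}" by blast
  have mem: "v \<in> {p, q} \<longleftrightarrow> v \<notin> ?R \<and> insert v ?R \<in> \<Delta>" for v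
    using pq(2) by blast
  have sub: "v \<in> {a, b, c, e}" if "v \<in> {p, q}" for v
    using that sphere_vertices(2)[of "insert v ?R"] unfolding mem by blast
  have "insert e ?R = V - {a, b, c}" "insert a ?R = V - {b, c, e}" "insert b ?R = V - {a, c, e}"
    "insert c ?R = V - {a, b, e}" using V e ne by auto
  then have "e \<in> {p, q}" "a \<in> {p, q} \<longleftrightarrow> V - {b, c, e} \<in> \<Delta>"
    "b \<in> {p, q} \<longleftrightarrow> V - {a, c, e} \<in> \<Delta>" "c \<in> {p, q} \<longleftrightarrow> V - {a, b, e} \<in> \<Delta>"
    unfolding mem using tD by simp_all
  moreover have "{b, c, e} \<in> cofacets V \<Delta> \<longleftrightarrow> V - {b, c, e} \<in> \<Delta>"
    "{a, c, e} \<in> cofacets V \<Delta> \<longleftrightarrow> V - {a, c, e} \<in> \<Delta>"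
    "{a, b, e} \<in> cofacets V \<Delta> \<longleftrightarrow> V - {a, b, e} \<in> \<Delta>"
    using V e ne by (auto simp: cofacets_def)
  ultimately show ?thesis
    using ne e(2) pq(1) sub[of p] sub[of q] by (smt (verit) insert_iff singletonD)
qed

text \<open>The ten triples below are the complements of the facets of the six-vertex triangulation
  of the projective plane. It violates the condition on the top homology unless \<open>2 = 0\<close> in the
  field, and then the condition on the first homology.\<close>

lemma no_projective_plane:
  assumes dist: "distinct [x, y0, y1, y2, y3, y4]" and V: "{x, y0, y1, y2, y3, y4} \<subseteq> V"
    and Tx: "{x, y0, y1} \<in> cofacets V \<Delta>" "{x, y1, y2} \<in> cofacets V \<Delta>" "{x, y2, y3} \<in> cofacets V \<Delta>"
      "{x, y3, y4} \<in> cofacets V \<Delta>" "{x, y4, y0} \<in> cofacets V \<Delta>"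
    and Ty: "{y0, y1, y3} \<in> cofacets V \<Delta>" "{y1, y2, y4} \<in> cofacets V \<Delta>" "{y2, y3, y0} \<in> cofacets V \<Delta>"
      "{y3, y4, y1} \<in> cofacets V \<Delta>" "{y4, y0, y2} \<in> cofacets V \<Delta>"
  shows False
proof -
  define T where "T = cofacets V \<Delta>"
  define W where "W = {x, y0, y1, y2, y3, y4}"
  define F where "F = V - W"
  define L where "L = face_link \<Delta> F"
  \<comment> \<open>The ten triples form two orbits under rotation of the pentagon
    \<open>y0, ..., y4\<close>. Since \<open>P\<close> is invariant under rotation, each fact below
    is proved for one representative and then rotated.\<close>
  define P where "P y0 y1 y2 y3 y4 \<longleftrightarrow> distinct [x, y0, y1, y2, y3, y4] \<and> {x, y0, y1, y2, y3, y4} = W \<and>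
    {x, y0, y1} \<in> T \<and> {x, y1, y2} \<in> T \<and> {x, y2, y3} \<in> T \<and> {x, y3, y4} \<in> T \<and> {x, y4, y0} \<in> T \<and>
    {y0, y1, y3} \<in> T \<and> {y1, y2, y4} \<in> T \<and> {y2, y3, y0} \<in> T \<and> {y3, y4, y1} \<in> T \<and> {y4, y0, y2} \<in> T"
    for y0 y1 y2 y3 y4
  have P0: "P y0 y1 y2 y3 y4" using assms by (simp add: P_def T_def W_def)
  have rot: "P y1 y2 y3 y4 y0" if "P y0 y1 y2 y3 y4" for y0 y1 y2 y3 y4
    using that unfolding P_def by (auto simp: insert_commute)
  have P1: "P y1 y2 y3 y4 y0" using P0 by (rule rot)
  have P2: "P y2 y3 y4 y0 y1" using P1 by (rule rot)
  have P3: "P y3 y4 y0 y1 y2" using P2 by (rule rot)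
  have P4: "P y4 y0 y1 y2 y3" using P3 by (rule rot)
  have finW: "finite W" by (simp add: W_def)
  have WV: "W \<subseteq> V" using V by (simp add: W_def)
  \<comment> \<open>Inside \<open>W\<close>, the facets of the link are again complements of
    triples, now with respect to the six vertices of \<open>W\<close>.\<close>
  have L_iff: "S \<in> L \<longleftrightarrow> S \<subseteq> W \<and> (\<exists>t\<in>T. t \<subseteq> W - S)" for S
  proof -
    have "S \<in> L \<longleftrightarrow> S \<inter> F = {} \<and> S \<union> F \<subseteq> V \<and> (\<exists>t\<in>T. t \<inter> (S \<union> F) = {})"
      unfolding L_def face_link_def T_def using sphere_face_iff[of "S \<union> F"] by simp
    also have "\<dots> \<longleftrightarrow> S \<subseteq> W \<and> (\<exists>t\<in>T. t \<inter> (S \<union> F) = {})" using WV by (auto simp: F_def)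
    also have "\<dots> \<longleftrightarrow> S \<subseteq> W \<and> (\<exists>t\<in>T. t \<subseteq> W - S)"
    proof -
      have "t \<inter> (S \<union> F) = {} \<longleftrightarrow> t \<subseteq> W - S" if "t \<in> T" for t
        using that by (auto simp: T_def cofacets_def F_def)
      then show ?thesis by blast
    qed
    finally show ?thesis .
  qed
  have LW: "L \<subseteq> Pow W" using L_iff by blast
  have "{x, y0, y1} \<inter> F = {}" "F \<subseteq> V" by (auto simp: F_def W_def)
  with Tx(1) have "F \<in> \<Delta>" using sphere_face_iff[of F] by blast
  have "card W = 6" using dist by (simp add: W_def)
  then have cF: "int d - 1 - int (card F) = 2"
    using card_V card_mono[OF sphere_vertices(1) WV] finW WV by (simp add: F_def card_Diff_subset)
  have link: "complex_on (\<Union>L) L"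
    unfolding L_def using complex_on_link[OF sphere_complex[OF sphere] \<open>F \<in> \<Delta>\<close>] .
  have hom: "reduced_homology_dim TYPE('k) L i = (if i = 2 then 1 else 0)" for i
    using sphere_link[OF sphere \<open>F \<in> \<Delta>\<close>, of i] unfolding cF L_def[symmetric] .
  \<comment> \<open>The ten given triples are themselves non-faces of \<open>L\<close>: the exchange
    property keeps their complements in \<open>W\<close> out of \<open>T\<close>.\<close>
  have vanish: "c {x, y0, y1} = 0 \<and> c {y0, y1, y3} = 0"
    if P: "P y0 y1 y2 y3 y4" and c: "c \<in> face_chains L 2" for y0 y1 y2 y3 y4 and c :: "'a set \<Rightarrow> 'k"
  proof -
    have W: "W = {x, y0, y1, y2, y3, y4}" and dist: "distinct [x, y0, y1, y2, y3, y4]" using P by (auto simp: P_def)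
    have nT: "{y2, y3, y4} \<notin> T" "{x, y2, y4} \<notin> T"
      using P cofacet_exchange[of x y2 y3 y4] cofacet_exchange[of x y3 y4 y2] WV
      unfolding P_def T_def[symmetric] by (auto simp: insert_commute)
    have "S \<notin> L" if "W - S \<notin> T" "card (W - S) = 3" for S
    proof
      assume "S \<in> L"
      then obtain t where t: "t \<in> T" "t \<subseteq> W - S" using L_iff by blast
      then have "t = W - S" using that(2) finW by (intro card_subset_eq) (auto simp: T_def cofacets_def)
      then show False using t that by simp
    qed
    moreover have "W - {x, y0, y1} = {y2, y3, y4}" "W - {y0, y1, y3} = {x, y2, y4}" using W dist by auto
    ultimately have "{x, y0, y1} \<notin> L" "{y0, y1, y3} \<notin> L" using nT dist by auto
    then show ?thesis using c by (auto simp: face_chains_def)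
  qed
  \<comment> \<open>Of the four candidates for a third vertex, two drop out by
    \<open>vanish\<close>, so each edge lies in two triangles. The three edges represent the three
    orbits of the fifteen edges under rotation.\<close>
  have edge: "differential L c {x, y0} = order_sign x y0 * (oriented c x y0 y2 + oriented c x y0 y3) \<and>
    differential L c {y0, y2} = order_sign y0 y2 * (oriented c y0 y2 x + oriented c y0 y2 y1) \<and>
    differential L c {y0, y1} = order_sign y0 y1 * (oriented c y0 y1 y2 + oriented c y0 y1 y4)"
    if P: "P y0 y1 y2 y3 y4" and c: "c \<in> face_chains L 2" for y0 y1 y2 y3 y4 and c :: "'a set \<Rightarrow> 'k"
  proof -
    have W: "W = {x, y0, y1, y2, y3, y4}" and dist: "distinct [x, y0, y1, y2, y3, y4]" using P by (auto simp: P_def)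
    have cL: "\<And>S. c S \<noteq> 0 \<Longrightarrow> S \<in> L" using c by (simp add: face_chains_def)
    have R1: "P y1 y2 y3 y4 y0" using P by (rule rot)
    have R2: "P y2 y3 y4 y0 y1" using R1 by (rule rot)
    have R3: "P y3 y4 y0 y1 y2" using R2 by (rule rot)
    have R4: "P y4 y0 y1 y2 y3" using R3 by (rule rot)
    have v: "oriented c x y0 y1 = 0" "oriented c x y0 y4 = 0" "oriented c y0 y2 y3 = 0" "oriented c y0 y2 y4 = 0"
      "oriented c y0 y1 x = 0" "oriented c y0 y1 y3 = 0"
      using vanish[OF P c] vanish[OF R4 c] vanish[OF R2 c]
      by (simp_all add: oriented_eq_0_iff insert_commute)
    have rest: "W - {x, y0} = {y1, y2, y3, y4}" "W - {y0, y2} = {x, y1, y3, y4}" "W - {y0, y1} = {x, y2, y3, y4}"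
      using W dist by auto
    have ne: "x \<noteq> y0" "y0 \<noteq> y2" "y0 \<noteq> y1" using dist by auto
    have de: "differential L c {u, v} = order_sign u v * (\<Sum>w\<in>W - {u, v}. oriented c u v w)"
      if "u \<noteq> v" for u v
      by (rule differential_edge[OF finW LW _ that]) (rule cL)
    show ?thesis
      unfolding de[OF ne(1)] de[OF ne(2)] de[OF ne(3)] rest using dist v by simp
  qed
  have "(cycles L 2 :: ('a set \<Rightarrow> 'k) set) \<noteq> {0}"
  proof
    assume "(cycles L 2 :: ('a set \<Rightarrow> 'k) set) = {0}"
    then have "reduced_homology_dim TYPE('k) L 2 = 0"
      by (simp only: reduced_homology_dim_def chain_dim_zero diff_0_eq_0)
    then show False using hom[of 2] by simp
  qed
  then obtain c :: "'a set \<Rightarrow> 'k" where c: "c \<in> cycles L 2" "c \<noteq> 0"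
    using zero_in_cycles by blast
  then have c2: "c \<in> face_chains L 2" and dc: "\<And>S. differential L c S = 0" by (auto simp: cycles_def)
  let ?o = "oriented c"
  \<comment> \<open>The triangles \<open>{x, yi, y(i+2)}\<close> form a disc around
    \<open>x\<close>, and the triangles \<open>{yi, y(i+1), y(i+2)}\<close> form a Moebius band
    glued to its boundary. The first equation orients the disc, the second crosses the gluing edges,
    and the third runs along the band and reverses the orientation.\<close>
  have eqs: "?o x y0 y2 = ?o x y3 y0 \<and> ?o y0 y1 y2 = ?o x y0 y2 \<and> ?o y0 y1 y2 = - ?o y4 y0 y1"
    if P: "P y0 y1 y2 y3 y4" for y0 y1 y2 y3 y4
  proof -
    have dist: "distinct [x, y0, y1, y2, y3, y4]" using P by (auto simp: P_def)
    have "?o x y0 y2 + ?o x y0 y3 = 0" "?o y0 y2 x + ?o y0 y2 y1 = 0" "?o y0 y1 y2 + ?o y0 y1 y4 = 0"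
      using edge[OF P c2] by (simp_all add: dc order_sign_neq_0)
    moreover have "?o x y0 y3 = - ?o x y3 y0" "?o y0 y2 x = ?o x y0 y2" "?o y0 y2 y1 = - ?o y0 y1 y2"
      "?o y0 y1 y4 = ?o y4 y0 y1"
      using dist oriented_swap(2)[of x y0 y3 c] oriented_swap(2)[of y0 x y2 c] oriented_swap(1)[of x y0 y2 c]
        oriented_swap(2)[of y0 y1 y2 c] oriented_swap(2)[of y0 y4 y1 c] oriented_swap(1)[of y4 y0 y1 c]
      by auto
    ultimately show ?thesis by (simp add: eq_neg_iff_add_eq_0)
  qed
  define a where "a = ?o x y0 y2"
  have ax: "?o x y0 y2 = a" "?o x y3 y0 = a" "?o x y1 y3 = a" "?o x y4 y1 = a" "?o x y2 y4 = a"
    using eqs[OF P0] eqs[OF P1] eqs[OF P2] eqs[OF P3] eqs[OF P4] by (simp_all add: a_def)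
  have ay: "?o y0 y1 y2 = a" "?o y1 y2 y3 = a" "?o y2 y3 y4 = a" "?o y3 y4 y0 = a" "?o y4 y0 y1 = a"
    using eqs[OF P0] eqs[OF P1] eqs[OF P2] eqs[OF P3] eqs[OF P4] ax by simp_all
  have "a = - a" using eqs[OF P0] unfolding ay by blast
  \<comment> \<open>Each of the twenty triples of \<open>W\<close> is a non-face of \<open>L\<close>
    or has coefficient \<open>a\<close> up to sign, so \<open>a = 0\<close> would make the cycle
    vanish.\<close>
  have "a \<noteq> 0"
  proof
    assume "a = 0"
    then have z: "c {x, y0, y2} = 0" "c {x, y0, y3} = 0" "c {x, y1, y3} = 0" "c {x, y1, y4} = 0" "c {x, y2, y4} = 0"
      "c {y0, y1, y2} = 0" "c {y1, y2, y3} = 0" "c {y2, y3, y4} = 0" "c {y0, y3, y4} = 0" "c {y0, y1, y4} = 0"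
      using ax ay unfolding oriented_eq_0_iff[symmetric]
      by (simp_all add: oriented_eq_0_iff insert_commute)
    have z': "c {x, y0, y1} = 0" "c {x, y1, y2} = 0" "c {x, y2, y3} = 0" "c {x, y3, y4} = 0" "c {x, y0, y4} = 0"
      "c {y0, y1, y3} = 0" "c {y1, y2, y4} = 0" "c {y0, y2, y3} = 0" "c {y1, y3, y4} = 0" "c {y0, y2, y4} = 0"
      using vanish[OF P0 c2] vanish[OF P1 c2] vanish[OF P2 c2] vanish[OF P3 c2] vanish[OF P4 c2]
      by (simp_all add: insert_commute)
    have "c S = 0" for S
    proof (rule ccontr)
      assume "c S \<noteq> 0"
      then have "S \<in> Pow W" "card S = 3" using c2 LW by (auto simp: face_chains_def)
      then show False
        using \<open>c S \<noteq> 0\<close> z z' dist unfolding W_def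
        by (simp add: Pow_insert image_Un image_insert) (elim disjE; simp)
    qed
    then show False using c(2) by auto
  qed
  then have "(2::'k) = 0"
    using \<open>a = - a\<close> by (metis add_eq_0_iff mult_2 mult_eq_0_iff)
  then have neg: "(- 1 :: 'k) = 1"
    by (metis add_eq_0_iff one_add_one)
  have sg: "order_sign u v = (1::'k)" for u v :: 'a by (simp add: order_sign_def neg)
  have orc: "oriented c u v w = c {u, v, w}" for u v w and c :: "'a set \<Rightarrow> 'k"
    by (simp add: oriented_def sg)
  \<comment> \<open>In characteristic 2 the obstruction moves to degree 1: the boundary of the
    missing triangle \<open>{x, y0, y1}\<close> is a closed path in \<open>L\<close> that does not
    bound there. Computed in the full simplex \<open>Pow W\<close>, it is a cycle for free.\<close>
  define \<tau> where "\<tau> = (\<lambda>S. if S = {x, y0, y1} then 1 else 0 :: 'k)"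
  define z where "z = differential (Pow W) \<tau>"
  have "complex_on W (Pow W)" using finW by (auto simp: complex_on_def)
  then have dz: "differential (Pow W) z = 0" unfolding z_def by (rule differential_differential)
  have z1: "z \<in> face_chains L 1"
    unfolding face_chains_def
  proof (intro CollectI allI impI)
    fix S assume "z S \<noteq> 0"
    then obtain v where v: "v \<notin> S" "\<tau> (insert v S) \<noteq> 0"
      unfolding z_def differential_def by (auto elim!: sum.not_neutral_contains_not_neutral)
    then have S: "insert v S = {x, y0, y1}" by (simp add: \<tau>_def split: if_splits)
    then have "S = {x, y0, y1} - {v}" "v \<in> {x, y0, y1}" using v by auto
    then have "S = {y0, y1} \<or> S = {x, y1} \<or> S = {x, y0}" using dist by auto
    moreover have "{y0, y1} \<in> L" "{x, y1} \<in> L" "{x, y0} \<in> L"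
      unfolding L_iff using P0 by (auto simp: P_def intro: bexI[of _ "{x, y2, y3}"] bexI[of _ "{y2, y3, y0}"] bexI[of _ "{y1, y2, y4}"])
    ultimately show "S \<in> L \<and> int (card S) = 1 + 1" using dist by auto
  qed
  moreover have "differential L z = differential (Pow W) z"
    by (rule differential_mono[OF finW LW order_refl]) (use z1 in \<open>simp add: face_chains_def\<close>)
  then have "differential L z = 0" using dz by simp
  ultimately have "z \<in> boundaries L 1"
    using homology_zero_exact[OF link, where 'k='k, of 1 z] hom[of 1] by (simp add: cycles_def)
  then obtain b :: "'a set \<Rightarrow> 'k" where b: "b \<in> face_chains L 2" "z = differential L b"
    by (auto simp: boundaries_def)
  have be: "z {y0, y1} = b {y0, y1, y2} + b {y0, y1, y4}" if "P y0 y1 y2 y3 y4" for y0 y1 y2 y3 y4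
    using edge[OF that b(1)] by (simp add: b(2) sg orc)
  \<comment> \<open>Modulo 2, summation over the five edges \<open>{yi, y(i+1)}\<close> is a cocycle
    on \<open>L\<close>: a triangle \<open>{yi, y(i+1), y(i+2)}\<close> contains two of these edges,
    any other triangle of \<open>L\<close> none. On \<open>z\<close> only the edge
    \<open>{y0, y1}\<close> contributes, and the sum is 1.\<close>
  have "z {y0, y1} + z {y1, y2} + z {y2, y3} + z {y3, y4} + z {y4, y0} =
    2 * (b {y0, y1, y2} + b {y1, y2, y3} + b {y2, y3, y4} + b {y3, y4, y0} + b {y4, y0, y1})"
    using be[OF P0] be[OF P1] be[OF P2] be[OF P3] be[OF P4] by (simp add: insert_commute)
  also have "\<dots> = 0" using \<open>2 = 0\<close> by simp
  finally have sum0: "z {y0, y1} + z {y1, y2} + z {y2, y3} + z {y3, y4} + z {y4, y0} = 0" .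
  have ze: "z {u, v} = (\<Sum>w\<in>W - {u, v}. \<tau> {u, v, w})" if "u \<noteq> v" for u v
  proof -
    have "differential (Pow W) \<tau> {u, v} = order_sign u v * (\<Sum>w\<in>W - {u, v}. oriented \<tau> u v w)"
      by (rule differential_edge[OF finW order_refl _ that]) (auto simp: \<tau>_def W_def split: if_splits)
    then show ?thesis by (simp add: z_def sg orc)
  qed
  have "W - {y0, y1} = {x, y2, y3, y4}" using dist by (auto simp: W_def)
  moreover have "{y0, y1, x} = {x, y0, y1}" "{y0, y1, y2} \<noteq> {x, y0, y1}" "{y0, y1, y3} \<noteq> {x, y0, y1}"
    "{y0, y1, y4} \<noteq> {x, y0, y1}" using dist by auto
  ultimately have "z {y0, y1} = 1" using dist by (simp add: ze \<tau>_def)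
  moreover have "z {u, v} = 0" if "u \<noteq> v" "v \<notin> {x, y0, y1} \<or> u \<notin> {x, y0, y1}" for u v
    unfolding ze[OF that(1)] using that(2) by (intro sum.neutral) (auto simp: \<tau>_def)
  then have "z {y1, y2} = 0" "z {y2, y3} = 0" "z {y3, y4} = 0" "z {y4, y0} = 0" using dist by auto
  ultimately show False using sum0 by simp
qed

end


section \<open>Suspensions and systems of triples\<close>

lemma complex_iso_image:
  assumes "inj_on f (\<Union>\<Delta>)"
  shows "complex_iso \<Delta> ((`) f ` \<Delta>)"
  unfolding complex_iso_def using assms
  by (intro exI[of _ f]) (auto simp: bij_betw_def)

text \<open>In either kind of suspension the link of the new vertex is the original complex, so the
  link of \<open>v\<close> is the only candidate. Whether \<open>{u, v}\<close> is a face decides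
  between the one-point suspension at \<open>u\<close> and the two-point suspension.\<close>

lemma suspended_if_twins:
  assumes \<Delta>: "complex_on V \<Delta>" and uv: "v \<in> V" "u \<noteq> v"
    and twins: "\<And>S. S \<in> \<Delta> \<Longrightarrow> u \<notin> S \<Longrightarrow> v \<notin> S \<Longrightarrow> insert u S \<in> \<Delta> \<and> insert v S \<in> \<Delta>"
  shows "\<not> unsuspended \<Delta>"
proof -
  let ?\<Gamma> = "face_link \<Delta> {v}"
  note down = complex_on_closed[OF \<Delta>]
  have "{v} \<in> \<Delta>" using \<Delta> uv by (simp add: complex_on_def)
  then have \<Gamma>: "complex_on (\<Union>?\<Gamma>) ?\<Gamma>" by (rule complex_on_link[OF \<Delta>])
  have v: "v \<notin> \<Union>?\<Gamma>" by (auto simp: face_link_def)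
  have \<Gamma>_iff: "S \<in> ?\<Gamma> \<longleftrightarrow> v \<notin> S \<and> insert v S \<in> \<Delta>" for S
    by (auto simp: face_link_def)
  have base: "X - {u, v} \<in> ?\<Gamma>" if "X \<in> \<Delta>" for X
    using down[OF that, of "X - {u, v}"] twins[of "X - {u, v}"] by (auto simp: \<Gamma>_iff)
  have lower: "S \<in> \<Delta> \<and> insert u S \<in> \<Delta> \<and> insert v S \<in> \<Delta>" if "S \<in> ?\<Gamma>" "u \<notin> S" for S
    using that down[of "insert v S" S] twins[of S] by (auto simp: \<Gamma>_iff)
  have cases: "X = X - {u, v} \<or> X = insert u (X - {u, v}) \<or> X = insert v (X - {u, v}) \<or>
    X = insert u (insert v (X - {u, v})) \<and> u \<in> X \<and> v \<in> X" for X
    by blast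
  have step: "suspension_step ?\<Gamma> \<Delta>"
  proof (cases "{u, v} \<in> \<Delta>")
    case True
    have "one_point_suspension u v ?\<Gamma> = \<Delta>"
    proof
      show "one_point_suspension u v ?\<Gamma> \<subseteq> \<Delta>"
        using lower unfolding one_point_suspension_def face_link_def[of ?\<Gamma>]
        by (auto simp: \<Gamma>_iff insert_commute)
      show "\<Delta> \<subseteq> one_point_suspension u v ?\<Gamma>"
      proof
        fix X assume X: "X \<in> \<Delta>"
        have "X - {u, v} \<in> face_link ?\<Gamma> {u}" if "u \<in> X" "v \<in> X"
        proof -
          have "insert v (insert u (X - {u, v})) = X" using that by blast
          then show ?thesis using X uv by (simp add: face_link_def[of ?\<Gamma>] \<Gamma>_iff)
        qed
        then show "X \<in> one_point_suspension u v ?\<Gamma>"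
          using cases[of X] base[OF X] unfolding one_point_suspension_def by fastforce
      qed
    qed
    moreover have "u \<in> \<Union>?\<Gamma>" using True uv(2) by (auto simp: \<Gamma>_iff insert_commute intro!: bexI[of _ "{u}"])
    ultimately show ?thesis using suspension_step.one_point[OF _ v] by metis
  next
    case False
    have u: "u \<notin> \<Union>?\<Gamma>"
    proof
      assume "u \<in> \<Union>?\<Gamma>"
      then obtain S where "u \<in> S" "insert v S \<in> \<Delta>" by (auto simp: \<Gamma>_iff)
      then show False using down[of "insert v S" "{u, v}"] False by simp
    qed
    have "two_point_suspension u v ?\<Gamma> = \<Delta>"
    proof
      show "two_point_suspension u v ?\<Gamma> \<subseteq> \<Delta>"
        using lower u unfolding two_point_suspension_def by auto
      show "\<Delta> \<subseteq> two_point_suspension u v ?\<Gamma>"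
      proof
        fix X assume X: "X \<in> \<Delta>"
        then have "\<not> (u \<in> X \<and> v \<in> X)" using False down[of X "{u, v}"] by auto
        then show "X \<in> two_point_suspension u v ?\<Gamma>"
          using cases[of X] base[OF X] unfolding two_point_suspension_def by fastforce
      qed
    qed
    then show ?thesis using suspension_step.two_point[OF u v uv(2)] by metis
  qed
  have "complex_iso \<Delta> \<Delta>" using complex_iso_image[of id \<Delta>] by simp
  then show ?thesis unfolding unsuspended_def using \<Gamma> step by blast
qed

definition alternating_triples :: "nat \<Rightarrow> nat set set" where
  "alternating_triples n =
    {{i, j, l} | i j l. 1 \<le> i \<and> i < j \<and> j < l \<and> l \<le> n \<and> even i \<noteq> even j \<and> even j \<noteq> even l}"

lemma alternating_triples_iff:
  assumes "i < j" "j < l"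
  shows "{i, j, l} \<in> alternating_triples n \<longleftrightarrow> 1 \<le> i \<and> l \<le> n \<and> even i \<noteq> even j \<and> even j \<noteq> even l"
proof
  assume "{i, j, l} \<in> alternating_triples n"
  then obtain i' j' l' where e: "{i, j, l} = {i', j', l'}" and o: "i' < j'" "j' < l'"
    and r: "1 \<le> i'" "l' \<le> n" "even i' \<noteq> even j'" "even j' \<noteq> even l'"
    by (auto simp: alternating_triples_def)
  have "i \<in> {i', j', l'}" "j \<in> {i', j', l'}" "l \<in> {i', j', l'}" using e by blast+
  then have "i = i'" "j = j'" "l = l'" using assms o by auto
  then show "1 \<le> i \<and> l \<le> n \<and> even i \<noteq> even j \<and> even j \<noteq> even l" using r by simp
qed (use assms in \<open>auto simp: alternating_triples_def\<close>)

text \<open>The properties of the complements of facets from which the rest is pure combinatorics.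
  The conditions in \<open>no_twins\<close> express interchangeability on complements: every facet
  contains \<open>u\<close> or \<open>v\<close>, and in a facet containing just one of them it may
  be replaced by the other.\<close>

locale triple_system =
  fixes V :: "'a set" and T :: "'a set set"
  assumes finite_V: "finite V" and T_nonempty: "T \<noteq> {}"
    and triple: "t \<in> T \<Longrightarrow> t \<subseteq> V" "t \<in> T \<Longrightarrow> card t = 3"
    and exchange: "{a, b, c} \<in> T \<Longrightarrow> e \<in> V \<Longrightarrow> e \<notin> {a, b, c} \<Longrightarrow>
      {b, c, e} \<in> T \<and> {a, c, e} \<notin> T \<and> {a, b, e} \<notin> T \<or>
      {b, c, e} \<notin> T \<and> {a, c, e} \<in> T \<and> {a, b, e} \<notin> T \<or>
      {b, c, e} \<notin> T \<and> {a, c, e} \<notin> T \<and> {a, b, e} \<in> T"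
    and no_hexad: "distinct [x, y0, y1, y2, y3, y4] \<Longrightarrow> {x, y0, y1, y2, y3, y4} \<subseteq> V \<Longrightarrow>
      {x, y0, y1} \<in> T \<Longrightarrow> {x, y1, y2} \<in> T \<Longrightarrow> {x, y2, y3} \<in> T \<Longrightarrow> {x, y3, y4} \<in> T \<Longrightarrow> {x, y4, y0} \<in> T \<Longrightarrow>
      {y0, y1, y3} \<in> T \<Longrightarrow> {y1, y2, y4} \<in> T \<Longrightarrow> {y2, y3, y0} \<in> T \<Longrightarrow> {y3, y4, y1} \<in> T \<Longrightarrow> {y4, y0, y2} \<in> T \<Longrightarrow>
      False"
    and no_twins: "u \<in> V \<Longrightarrow> v \<in> V \<Longrightarrow> u \<noteq> v \<Longrightarrow> \<forall>t\<in>T. \<not> {u, v} \<subseteq> t \<Longrightarrow>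
      \<forall>t\<in>T. u \<in> t \<longrightarrow> insert v (t - {u}) \<in> T \<Longrightarrow> \<forall>t\<in>T. v \<in> t \<longrightarrow> insert u (t - {v}) \<in> T \<Longrightarrow> False"

section \<open>The graph of a triple system at a vertex\<close>

locale pointed_triple_system = triple_system +
  fixes x :: 'a
  assumes x: "x \<in> V"
begin

abbreviation X where "X \<equiv> V - {x}"

definition edge :: "'a \<Rightarrow> 'a \<Rightarrow> bool" where "edge y z \<longleftrightarrow> {x, y, z} \<in> T"

definition nbrs :: "'a \<Rightarrow> 'a set" where "nbrs y = {z. edge y z}"

abbreviation deg where "deg y \<equiv> card (nbrs y)"

lemma edge_sym: "edge y z \<Longrightarrow> edge z y"
  by (simp add: edge_def insert_commute)

lemma triple_distinct: "{a, b, c} \<in> T \<Longrightarrow> a \<noteq> b \<and> a \<noteq> c \<and> b \<noteq> c"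
  using triple(2)[of "{a, b, c}"] by (auto simp: card_insert_if split: if_splits)

lemma edge_in: "edge y z \<Longrightarrow> y \<in> X \<and> z \<in> X \<and> y \<noteq> z"
  using triple(1)[of "{x, y, z}"] triple_distinct[of x y z] by (auto simp: edge_def)

lemma edge_exchange:
  assumes "edge y z" "w \<in> X" "w \<noteq> y" "w \<noteq> z"
  shows "{y, z, w} \<in> T \<and> \<not> edge z w \<and> \<not> edge y w \<or>
    {y, z, w} \<notin> T \<and> edge z w \<and> \<not> edge y w \<or> {y, z, w} \<notin> T \<and> \<not> edge z w \<and> edge y w"
  using assms exchange[of x y z w] by (simp add: edge_def)

text \<open>Together with \<open>x\<close>, a triangle would span a 4-set containing at least three
  triples.\<close>

lemma triangle_free: "edge y z \<Longrightarrow> edge z w \<Longrightarrow> \<not> edge y w"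
  using edge_exchange[of y z w] edge_in[of z w] edge_in[of y w] by blast

text \<open>The 4-set formed with \<open>x\<close> contains 0 or 2 triples, so
  \<open>{y, z, w}\<close> is needed precisely to accompany a single edge.\<close>

lemma triple_iff:
  assumes "y \<in> X" "z \<in> X" "w \<in> X" "y \<noteq> z" "y \<noteq> w" "z \<noteq> w"
  shows "{y, z, w} \<in> T \<longleftrightarrow> edge y z \<and> \<not> edge z w \<and> \<not> edge y w \<or>
    \<not> edge y z \<and> edge z w \<and> \<not> edge y w \<or> \<not> edge y z \<and> \<not> edge z w \<and> edge y w"
proof -
  have "{y, z, w} \<notin> T" if "\<not> edge y z" "\<not> edge z w" "\<not> edge y w"
    using that exchange[of y z w x] assms x by (auto simp: edge_def insert_commute)
  moreover have "{z, w, y} = {y, z, w}" "{y, w, z} = {y, z, w}" by auto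
  ultimately show ?thesis
    using edge_exchange[of y z w] edge_exchange[of z w y] edge_exchange[of y w z] assms edge_sym by metis
qed

text \<open>Each of the four triples in \<open>{y, z, w, v}\<close> spans exactly one edge, so all
  four would belong to \<open>T\<close>.\<close>

lemma no_two_disjoint_edges:
  assumes e: "edge y z" "edge w v" and n: "\<not> edge y w" "\<not> edge y v" "\<not> edge z w" "\<not> edge z v"
  shows False
proof -
  have ne: "y \<noteq> w" "y \<noteq> v" "z \<noteq> w" "z \<noteq> v" "y \<noteq> z" "w \<noteq> v" using e n edge_sym edge_in by metis+
  have X: "y \<in> X" "z \<in> X" "w \<in> X" "v \<in> X" using e edge_in by blast+
  have "{y, z, w} \<in> T" "{y, z, v} \<in> T" "{z, w, v} \<in> T" "{y, w, v} \<in> T"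
    using triple_iff X ne e n by presburger+
  then show False using exchange[of y z w v] X ne by auto
qed

text \<open>The edges give the five triples through \<open>x\<close>; each
  \<open>{yi, y(i+1), y(i+3)}\<close> spans a single edge, which gives the other five.\<close>

lemma no_induced_pentagon:
  assumes e: "edge y0 y1" "edge y1 y2" "edge y2 y3" "edge y3 y4" "edge y4 y0"
    and n: "\<not> edge y0 y2" "\<not> edge y1 y3" "\<not> edge y2 y4" "\<not> edge y3 y0" "\<not> edge y4 y1"
  shows False
proof -
  have X: "y0 \<in> X" "y1 \<in> X" "y2 \<in> X" "y3 \<in> X" "y4 \<in> X" using e edge_in by blast+
  have ne: "y0 \<noteq> y1" "y1 \<noteq> y2" "y2 \<noteq> y3" "y3 \<noteq> y4" "y4 \<noteq> y0" using e edge_in by blast+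
  have ne': "y0 \<noteq> y2" "y1 \<noteq> y3" "y2 \<noteq> y4" "y3 \<noteq> y0" "y4 \<noteq> y1" using e n edge_sym by metis+
  have n': "\<not> edge y2 y0" "\<not> edge y3 y1" "\<not> edge y4 y2" "\<not> edge y0 y3" "\<not> edge y1 y4"
    using n edge_sym by blast+
  show False
    using no_hexad[of x y0 y1 y2 y3 y4] e X ne ne' x
      triple_iff[of y0 y1 y3] triple_iff[of y1 y2 y4] triple_iff[of y2 y3 y0] triple_iff[of y3 y4 y1]
      triple_iff[of y4 y0 y2] n n'
    by (auto simp: edge_def)
qed

lemma triple_elems:
  assumes "t \<in> T" "u \<in> t"
  obtains z w where "t = {u, z, w}" "z \<noteq> u" "w \<noteq> u" "z \<noteq> w" "z \<in> V" "w \<in> V"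
proof -
  have "card (t - {u}) = 2" using assms triple(2)[OF assms(1)] by (simp add: card_Diff_singleton)
  then obtain z w where zw: "t - {u} = {z, w}" "z \<noteq> w" by (auto simp: card_2_iff)
  then have "t = {u, z, w}" "z \<noteq> u" "w \<noteq> u" using assms(2) by blast+
  then show ?thesis using that zw triple(1)[OF assms(1)] by simp
qed

text \<open>If \<open>y\<close> is isolated, a pair of other vertices forms a triple with
  \<open>y\<close> exactly when it forms one with \<open>x\<close>, so \<open>x\<close> and
  \<open>y\<close> would be twins.\<close>

lemma not_isolated:
  assumes y: "y \<in> X"
  shows "nbrs y \<noteq> {}"
proof
  assume "nbrs y = {}"
  then have iso: "\<not> edge y z" "\<not> edge z y" for z using edge_sym by (auto simp: nbrs_def)
  show False
  proof (rule no_twins[of x y])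
    show "\<forall>t\<in>T. \<not> {x, y} \<subseteq> t"
    proof (intro ballI notI)
      fix t assume t: "t \<in> T" "{x, y} \<subseteq> t"
      then obtain z w where "t = {x, z, w}" using triple_elems[of t x] by (metis insert_subset)
      moreover have "edge z w" using t calculation by (simp add: edge_def)
      ultimately show False using t(2) y iso by auto
    qed
    show "\<forall>t\<in>T. x \<in> t \<longrightarrow> insert y (t - {x}) \<in> T"
    proof (intro ballI impI)
      fix t assume t: "t \<in> T" "x \<in> t"
      obtain z w where zw: "t = {x, z, w}" "z \<noteq> x" "w \<noteq> x" using triple_elems[OF t] by metis
      have e: "edge z w" using t zw by (simp add: edge_def)
      then have "z \<noteq> y" "w \<noteq> y" using iso by auto
      then have "{z, w, y} \<in> T" using edge_exchange[OF e y] iso by auto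
      moreover have "insert y (t - {x}) = {z, w, y}" using zw by auto
      ultimately show "insert y (t - {x}) \<in> T" by simp
    qed
    show "\<forall>t\<in>T. y \<in> t \<longrightarrow> insert x (t - {y}) \<in> T"
    proof (intro ballI impI)
      fix t assume t: "t \<in> T" "y \<in> t"
      obtain z w where zw: "t = {y, z, w}" "z \<noteq> y" "w \<noteq> y" "z \<noteq> w" "z \<in> V" "w \<in> V"
        using triple_elems[OF t] by metis
      have "t = {x, y, w}" if "z = x" using zw that by auto
      moreover have "t = {x, y, z}" if "w = x" using zw that by auto
      ultimately have "z \<noteq> x" "w \<noteq> x" using t(1) iso unfolding edge_def by metis+
      then have "edge z w" using triple_iff[of y z w] zw y t iso by auto
      moreover have "insert x (t - {y}) = {x, z, w}" using zw by auto
      ultimately show "insert x (t - {y}) \<in> T" by (simp add: edge_def)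
    qed
  qed (use x y in auto)
qed

text \<open>Triples are decided by adjacency alone, so equal neighbourhoods make \<open>y\<close>
  and \<open>y'\<close> interchangeable. No triple contains both, as they span 0 or 2 edges with any
  third vertex other than \<open>x\<close>.\<close>

lemma nbrs_distinct:
  assumes y: "y \<in> X" "y' \<in> X" "y \<noteq> y'" and n: "\<not> edge y y'"
  shows "nbrs y \<noteq> nbrs y'"
proof
  assume "nbrs y = nbrs y'"
  then have eq: "edge y z \<longleftrightarrow> edge y' z" "edge z y \<longleftrightarrow> edge z y'" for z using edge_sym unfolding nbrs_def by blast+
  have swap: "insert v (t - {u}) \<in> T"
    if t: "t \<in> T" "u \<in> t" "v \<notin> t" and uv: "u \<in> X" "v \<in> X" and eq: "\<And>z. edge u z \<longleftrightarrow> edge v z" for u v t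
  proof -
    obtain z w where zw: "t = {u, z, w}" "z \<noteq> u" "w \<noteq> u" "z \<noteq> w" "z \<in> V" "w \<in> V"
      using triple_elems[OF t(1,2)] by metis
    have r: "insert v (t - {u}) = {v, z, w}" using zw by auto
    have "{v, z, w} \<in> T"
    proof (cases "z = x \<or> w = x")
      case True
      then obtain w' where "{z, w} = {x, w'}" by blast
      then have "t = {x, u, w'}" "{v, z, w} = {x, v, w'}" using zw by auto
      then show ?thesis using t(1) eq[of w'] by (simp add: edge_def)
    next
      case False
      then show ?thesis using triple_iff[of u z w] triple_iff[of v z w] zw t uv eq by auto
    qed
    then show ?thesis using r by simp
  qed
  have both: "\<forall>t\<in>T. \<not> {y, y'} \<subseteq> t"
  proof (intro ballI notI)
    fix t assume t: "t \<in> T" "{y, y'} \<subseteq> t"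
    then obtain z w where zw: "t = {y, z, w}" "z \<noteq> y" "w \<noteq> y" "z \<noteq> w" "z \<in> V" "w \<in> V"
      using triple_elems[of t y] by (metis insert_subset)
    then obtain z where z: "t = {y, y', z}" "z \<noteq> y" "z \<noteq> y'" "z \<in> V" using t(2) y(3) by blast
    show False
    proof (cases "z = x")
      case True
      then show False using t(1) z n by (simp add: edge_def insert_commute)
    next
      case False
      then show False using triple_iff[of y y' z] y z t(1) n eq by auto
    qed
  qed
  show False
    by (rule no_twins[OF _ _ y(3) both]) (use y both swap[of _ y y'] swap[of _ y' y] eq in auto)
qed

lemma finite_nbrs: "finite (nbrs y)"
  using finite_subset[of "nbrs y" V] finite_V edge_in by (auto simp: nbrs_def)

section \<open>Bipartition, nested neighbourhoods and the half graph\<close>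

definition independent :: "'a set \<Rightarrow> bool" where
  "independent I \<longleftrightarrow> (\<forall>y\<in>I. \<forall>z\<in>I. \<not> edge y z)"

lemma bipartition:
  obtains A where "A \<subseteq> X" "independent A" "independent (X - A)"
proof -
  have "X \<noteq> {}"
  proof
    assume "X = {}"
    then have "V \<subseteq> {x}" by blast
    moreover obtain t where "t \<in> T" using T_nonempty by blast
    ultimately have "t \<subseteq> {x}" "card t = 3" using triple by blast+
    then show False using card_mono[of "{x}" t] by simp
  qed
  then have "Max (deg ` X) \<in> deg ` X" using finite_V by (intro Max_in) auto
  then obtain a where a: "a \<in> X" "Max (deg ` X) = deg a" by (rule imageE)
  have max: "deg y \<le> deg a" if "y \<in> X" for y
    unfolding a(2)[symmetric] using finite_V that by (intro Max_ge) auto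
  let ?B = "nbrs a"
  have "independent ?B"
    unfolding independent_def nbrs_def using triangle_free edge_sym by blast
  moreover have "independent (X - ?B)"
    unfolding independent_def
  proof (intro ballI notI)
    fix u v assume u: "u \<in> X - ?B" and v: "v \<in> X - ?B" and uv: "edge u v"
    have n: "\<not> edge a u" "\<not> edge a v" using u v by (auto simp: nbrs_def)
    \<comment> \<open>Otherwise \<open>{a, b}\<close> and \<open>{u, v}\<close> would be an induced
      pair of disjoint edges; edges from \<open>a\<close> to \<open>u\<close> or \<open>v\<close>
      are already excluded.\<close>
    have one: "edge b u \<or> edge b v" if "edge a b" for b
      using no_two_disjoint_edges[OF that uv] n by blast
    \<comment> \<open>If every neighbour of \<open>a\<close> were adjacent to \<open>u\<close>, the
      additional neighbour \<open>v\<close> would lift the degree of \<open>u\<close> above the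
      maximum.\<close>
    have not_all: "\<exists>b. edge a b \<and> \<not> edge b u" if uv: "edge u v" and u: "u \<in> X" and "\<not> edge a v" for u v
    proof (rule ccontr)
      assume "\<not> ?thesis"
      then have "nbrs a \<subset> nbrs u" using uv \<open>\<not> edge a v\<close> edge_sym unfolding nbrs_def by blast
      then have "deg a < deg u" using finite_nbrs by (simp add: psubset_card_mono)
      then show False using max[OF u] by simp
    qed
    obtain b where b: "edge a b" "\<not> edge b u" using not_all[OF uv] u n by blast
    obtain b' where b': "edge a b'" "\<not> edge b' v" using not_all[OF edge_sym[OF uv]] v n by blast
    have "edge b v" "edge b' u" using one b b' by blast+
    moreover have "\<not> edge b b'" using triangle_free[of a b b'] b b' by blast
    \<comment> \<open>The cycle \<open>a, b, v, u, b'\<close> is an induced pentagon.\<close>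
    ultimately show False
      using no_induced_pentagon[of a b v u b'] b b' n uv edge_sym by blast
  qed
  ultimately show ?thesis using that[of ?B] edge_in by (auto simp: nbrs_def)
qed

text \<open>Private neighbours of \<open>y\<close> and \<open>y'\<close> would give two disjoint
  edges, induced because both sides are independent.\<close>

lemma nested:
  assumes "independent I" "independent (X - I)" "y \<in> I" "y' \<in> I" "I \<subseteq> X"
  shows "nbrs y \<subseteq> nbrs y' \<or> nbrs y' \<subseteq> nbrs y"
proof (rule ccontr)
  assume "\<not> ?thesis"
  then obtain z z' where z: "edge y z" "\<not> edge y' z" "edge y' z'" "\<not> edge y z'" by (auto simp: nbrs_def)
  then have "z \<in> X - I" "z' \<in> X - I" using assms edge_in unfolding independent_def by blast+
  then show False
    using no_two_disjoint_edges[of y z y' z'] z assms edge_sym unfolding independent_def by blast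
qed

lemma nbrs_other_side:
  assumes "independent I" "y \<in> I" "I \<subseteq> X"
  shows "nbrs y \<subseteq> X - I"
  using assms edge_in unfolding independent_def nbrs_def by blast

text \<open>Nested neighbourhoods of equal size coincide, which \<open>nbrs_distinct\<close>
  excludes. The degree can therefore serve as a coordinate along each side.\<close>

lemma deg_inj:
  assumes I: "independent I" "independent (X - I)" "I \<subseteq> X"
  shows "inj_on deg I" "deg ` I \<subseteq> {1..card (X - I)}"
proof -
  show "inj_on deg I"
  proof (rule inj_onI, rule ccontr)
    fix y y' assume y: "y \<in> I" "y' \<in> I" "deg y = deg y'" "y \<noteq> y'"
    have "nbrs y = nbrs y'"
      using nested[OF I(1,2) y(1,2) I(3)] y(3) finite_nbrs by (metis card_subset_eq)
    moreover have "\<not> edge y y'" using I(1) y by (simp add: independent_def)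
    ultimately show False using nbrs_distinct[of y y'] y I(3) by blast
  qed
  show "deg ` I \<subseteq> {1..card (X - I)}"
  proof
    fix k assume "k \<in> deg ` I"
    then obtain y where y: "y \<in> I" "k = deg y" by blast
    have "deg y \<noteq> 0" using not_isolated[of y] y I(3) finite_nbrs by auto
    moreover have "deg y \<le> card (X - I)"
      using nbrs_other_side[OF I(1) y(1) I(3)] finite_V by (intro card_mono) auto
    ultimately show "k \<in> {1..card (X - I)}" using y(2) by simp
  qed
qed

lemma card_side_le:
  assumes I: "independent I" "independent (X - I)" "I \<subseteq> X"
  shows "card I \<le> card (X - I)"
  using card_mono[OF _ deg_inj(2)[OF I]] card_image[OF deg_inj(1)[OF I]] by simp

text \<open>The degree bounds for both sides force equal sizes \<open>k\<close>, so the degrees on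
  each side run through \<open>{1..k}\<close> exactly once. The neighbourhood of \<open>b\<close> is
  closed upwards in degree and has \<open>deg b\<close> elements, hence consists of the vertices of
  degree above \<open>k - deg b\<close>.\<close>

lemma half_graph:
  obtains A k where "A \<subseteq> X" "independent A" "independent (X - A)" "bij_betw deg A {1..k}"
    "bij_betw deg (X - A) {1..k}" "\<And>a b. a \<in> A \<Longrightarrow> b \<in> X - A \<Longrightarrow> edge a b \<longleftrightarrow> k < deg a + deg b"
proof -
  obtain A where A: "A \<subseteq> X" "independent A" "independent (X - A)" using bipartition .
  let ?B = "X - A"
  define k where "k = card A"
  have BB: "X - ?B = A" using A(1) by blast
  have iB: "independent ?B" "independent (X - ?B)" "?B \<subseteq> X" using A BB by auto
  have k: "card ?B = k"
    using card_side_le[OF A(2,3,1)] card_side_le[OF iB] unfolding BB k_def by simp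
  have bij: "bij_betw deg A {1..k}" "bij_betw deg ?B {1..k}"
    using deg_inj[OF A(2,3,1)] deg_inj[OF iB] k unfolding BB bij_betw_def
    by (simp_all add: card_subset_eq card_image k_def)
  have "edge a b \<longleftrightarrow> k < deg a + deg b" if a: "a \<in> A" and b: "b \<in> ?B" for a b
  proof -
    have sub: "nbrs b \<subseteq> A" using nbrs_other_side[OF iB(1) b iB(3)] BB by simp
    have cb: "card (deg ` nbrs b) = deg b"
      using bij(1) sub by (intro card_image) (auto simp: bij_betw_def inj_on_def)
    have up: "a' \<in> nbrs b" if "a1 \<in> nbrs b" "a' \<in> A" "deg a1 \<le> deg a'" for a1 a'
    proof -
      have "nbrs a1 \<subseteq> nbrs a'"
        using nested[OF A(2,3) _ that(2) A(1), of a1] that sub finite_nbrs by (metis card_seteq subset_eq)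
      then show ?thesis using that(1) edge_sym unfolding nbrs_def by blast
    qed
    show ?thesis
    proof (cases "edge a b")
      case True
      then have ab: "a \<in> nbrs b" using edge_sym by (simp add: nbrs_def)
      have "{deg a..k} \<subseteq> deg ` nbrs b"
      proof
        fix i assume i: "i \<in> {deg a..k}"
        have "deg a \<ge> 1" using bij(1) a by (auto simp: bij_betw_def)
        then have "i \<in> deg ` A" using i bij(1) by (auto simp: bij_betw_def)
        then show "i \<in> deg ` nbrs b" using up[OF ab] i by auto
      qed
      then have "card {deg a..k} \<le> card (deg ` nbrs b)" by (intro card_mono finite_imageI finite_nbrs)
      then have "card {deg a..k} \<le> deg b" unfolding cb .
      then show ?thesis using True by simp
    next
      case False
      have "deg ` nbrs b \<subseteq> {deg a<..k}"
      proof
        fix i assume "i \<in> deg ` nbrs b"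
        then obtain a1 where a1: "a1 \<in> nbrs b" "i = deg a1" by blast
        have "deg a1 \<le> k" using bij_betwE[OF bij(1)] a1(1) sub by (meson atLeastAtMost_iff subsetD)
        moreover have "\<not> deg a1 \<le> deg a" using up[OF a1(1) a] False edge_sym by (auto simp: nbrs_def)
        ultimately show "i \<in> {deg a<..k}" using a1 by simp
      qed
      then have "card (deg ` nbrs b) \<le> card {deg a<..k}" by (intro card_mono) auto
      then have "deg b \<le> k - deg a" unfolding cb by simp
      moreover have "deg a \<le> k" using bij(1) a by (auto simp: bij_betw_def)
      ultimately show ?thesis using False by simp
    qed
  qed
  then show ?thesis using that A bij by blast
qed

lemma numbering_pointed:
  "\<exists>f. odd (card V) \<and> bij_betw f V {1..card V} \<and> (\<forall>t. t \<subseteq> V \<longrightarrow> (t \<in> T \<longleftrightarrow> f ` t \<in> alternating_triples (card V)))"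
proof -
  obtain A k where A: "A \<subseteq> X" "independent A" "independent (X - A)"
    and bij: "bij_betw deg A {1..k}" "bij_betw deg (X - A) {1..k}"
    and edge: "\<And>a b. a \<in> A \<Longrightarrow> b \<in> X - A \<Longrightarrow> edge a b \<longleftrightarrow> k < deg a + deg b"
    by (rule half_graph) blast
  have finA: "finite A" using A(1) finite_V finite_subset by blast
  have card_AB: "card A = k" "card (X - A) = k" using bij bij_betw_same_card by fastforce+
  have "card V = Suc (card X)" using x finite_V by (metis card_Suc_Diff1)
  also have "card X = card A + card (X - A)" using A(1) finA finite_V by (metis card_Diff_subset card_mono finite_Diff le_add_diff_inverse)
  finally have n: "card V = 2 * k + 1" using card_AB by simp
  \<comment> \<open>The side \<open>A\<close> receives the odd numbers by decreasing degree, the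
    other side the even numbers by increasing degree. The adjacency condition
    \<open>k < deg a + deg b\<close> then becomes \<open>f a < f b\<close>.\<close>
  define f where "f y = (if y = x then 2 * k + 1 else if y \<in> A then 2 * (k - deg y) + 1 else 2 * deg y)" for y
  have fx: "f x = 2 * k + 1" by (simp add: f_def)
  have fA: "f a = 2 * (k - deg a) + 1" "1 \<le> deg a" "deg a \<le> k" if "a \<in> A" for a
    using that A(1) bij(1) by (auto simp: f_def bij_betw_def)
  have fB: "f b = 2 * deg b" "1 \<le> deg b" "deg b \<le> k" if "b \<in> X - A" for b
    using that bij(2) by (auto simp: f_def bij_betw_def)
  have inj: "inj_on f V"
  proof (rule inj_onI)
    have par: "odd (f y) \<longleftrightarrow> y = x \<or> y \<in> A" for y by (simp add: f_def)
    fix y z assume yz: "y \<in> V" "z \<in> V" "f y = f z"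
    then have p: "(y = x \<or> y \<in> A) \<longleftrightarrow> (z = x \<or> z \<in> A)" using par by metis
    show "y = z"
    proof (cases "y = x \<or> z = x")
      case True
      then show ?thesis using p yz(3) fA[of y] fA[of z] fx by auto
    next
      case False
      show ?thesis
      proof (cases "y \<in> A")
        case True
        then have "z \<in> A" using p False by blast
        then have "deg y = deg z" using yz(3) fA[of y] fA[of z] True by simp
        then show ?thesis using bij(1) True \<open>z \<in> A\<close> by (auto simp: bij_betw_def dest: inj_onD)
      next
        case nA: False
        then have yz': "y \<in> X - A" "z \<in> X - A" using p False yz by blast+
        then have "deg y = deg z" using yz(3) fB[of y] fB[of z] by simp
        then show ?thesis using bij(2) yz' by (auto simp: bij_betw_def dest: inj_onD)
      qed
    qed
  qed
  have range: "f y \<in> {1..card V}" if "y \<in> V" for y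
    using that fx fA[of y] fB[of y] n by (cases "y = x"; cases "y \<in> A") auto
  have "f ` V = {1..card V}"
    using range inj by (intro card_subset_eq) (auto simp: card_image)
  then have bijf: "bij_betw f V {1..card V}" using inj by (simp add: bij_betw_def)
  have edge_f: "edge y z \<longleftrightarrow> odd (f y) \<and> even (f z)" if "y \<in> X" "z \<in> X" "f y < f z" for y z
  proof (cases "y \<in> A"; cases "z \<in> A")
    assume "y \<in> A" "z \<notin> A"
    then show ?thesis using edge[of y z] that fA[of y] fB[of z] by auto
  next
    assume yz: "y \<notin> A" "z \<in> A"
    have "\<not> edge z y" using edge[of z y] yz that fA[of z] fB[of y] by auto
    then show ?thesis using yz that fB[of y] edge_sym by auto
  qed (use A that fA fB in \<open>auto simp: independent_def\<close>)
  have main: "{p, q, r} \<in> T \<longleftrightarrow> {f p, f q, f r} \<in> alternating_triples (card V)"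
    if V: "p \<in> V" "q \<in> V" "r \<in> V" and o: "f p < f q" "f q < f r" for p q r
  proof -
    have alt: "{f p, f q, f r} \<in> alternating_triples (card V) \<longleftrightarrow>
      even (f p) \<noteq> even (f q) \<and> even (f q) \<noteq> even (f r)"
      using alternating_triples_iff[OF o] range V by auto
    \<comment> \<open>\<open>x\<close> carries the largest number, so only \<open>r\<close> can be
      \<open>x\<close>.\<close>
    have pq: "p \<in> X" "q \<in> X" using V o range[of q] range[of r] fx n by auto
    show ?thesis
    proof (cases "r = x")
      case True
      have "{p, q, r} \<in> T \<longleftrightarrow> edge p q" by (simp add: edge_def True insert_commute)
      then show ?thesis using edge_f[OF pq o(1)] alt fx True by auto
    next
      case False
      then have r: "r \<in> X" using V by simp
      have ne: "p \<noteq> q" "p \<noteq> r" "q \<noteq> r" using o by auto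
      \<comment> \<open>Among the three increasing pairs, exactly one leads from odd to even
        precisely when the parities alternate.\<close>
      show ?thesis
        unfolding alt triple_iff[OF pq r ne] edge_f[OF pq o(1)] edge_f[OF pq(2) r o(2)]
          edge_f[OF pq(1) r less_trans[OF o]] by auto
    qed
  qed
  have "t \<in> T \<longleftrightarrow> f ` t \<in> alternating_triples (card V)" if t: "t \<subseteq> V" for t
  proof
    assume "t \<in> T"
    then have "card (f ` t) = 3" using triple(2) card_image[OF inj_on_subset[OF inj t]] by simp
    then obtain i j l where ijl: "f ` t = {i, j, l}" "i < j" "j < l"
      by (auto simp: card_3_iff) (metis insert_commute linorder_neqE_nat)
    then obtain p q r where pqr: "p \<in> t" "q \<in> t" "r \<in> t" "i = f p" "j = f q" "l = f r"
      by (metis imageE insertCI)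
    have "f ` t = f ` {p, q, r}" using ijl pqr by simp
    then have "t = {p, q, r}" using inj_on_image_eq_iff[OF inj, of t "{p, q, r}"] t pqr by auto
    then show "f ` t \<in> alternating_triples (card V)" using main[of p q r] \<open>t \<in> T\<close> ijl pqr t by auto
  next
    assume "f ` t \<in> alternating_triples (card V)"
    then obtain i j l where ijl: "f ` t = {i, j, l}" "i < j" "j < l"
      by (auto simp: alternating_triples_def)
    then obtain p q r where pqr: "p \<in> t" "q \<in> t" "r \<in> t" "i = f p" "j = f q" "l = f r"
      by (metis imageE insertCI)
    have "f ` t = f ` {p, q, r}" using ijl pqr by simp
    then have "t = {p, q, r}" using inj_on_image_eq_iff[OF inj, of t "{p, q, r}"] t pqr by auto
    then show "t \<in> T" using main[of p q r] \<open>f ` t \<in> _\<close> ijl pqr t by auto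
  qed
  then show ?thesis using bijf n by (intro exI[of _ f]) auto
qed

end

lemma (in triple_system) numbering:
  obtains f where "odd (card V)" "bij_betw f V {1..card V}"
    "\<And>t. t \<subseteq> V \<Longrightarrow> t \<in> T \<longleftrightarrow> f ` t \<in> alternating_triples (card V)"
proof -
  obtain t where t: "t \<in> T" using T_nonempty by blast
  then have "t \<noteq> {}" using triple(2) by fastforce
  then obtain x where "x \<in> V" using triple(1)[OF t] by blast
  then interpret pointed_triple_system V T x by unfold_locales
  show ?thesis using numbering_pointed that by blast
qed


section \<open>Minimal non-faces\<close>

definition alternating_complex :: "nat \<Rightarrow> nat set set" where
  "alternating_complex n = {S. S \<subseteq> {1..n} \<and> (\<exists>t\<in>alternating_triples n. t \<inter> S = {})}"

text \<open>Labelling the vertices of a regular \<open>n\<close>-gon (\<open>n\<close> odd) so that \<open>i + 2\<close> follows \<open>i\<close>, there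
  is an arrow from \<open>i\<close> to each vertex on the half circle after \<open>i\<close>. The alternating triples are the
  cyclic triangles of this tournament, i.e. the triangles containing the centre.\<close>

definition arrow :: "nat \<Rightarrow> nat \<Rightarrow> bool" where
  "arrow i j \<longleftrightarrow> i < j \<and> even i \<noteq> even j \<or> j < i \<and> even i = even j"

definition out_nbrs :: "nat \<Rightarrow> nat \<Rightarrow> nat set" where
  "out_nbrs n i = {j\<in>{1..n}. arrow i j}"

lemma arrow_linear: "i \<noteq> j \<Longrightarrow> arrow i j \<longleftrightarrow> \<not> arrow j i"
  by (auto simp: arrow_def)

lemma arrow_irrefl: "\<not> arrow i i"
  by (simp add: arrow_def)

lemma cyclic_triangle:
  assumes a: "arrow i j" "arrow j l" "arrow l i" and r: "i \<in> {1..n}" "j \<in> {1..n}" "l \<in> {1..n}"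
  shows "{i, j, l} \<in> alternating_triples n"
proof -
  have "i < j \<and> j < l \<or> j < l \<and> l < i \<or> l < i \<and> i < j"
    using a unfolding arrow_def by (cases "even i"; cases "even j"; cases "even l") auto
  moreover have "{j, l, i} = {i, j, l}" "{l, i, j} = {i, j, l}" by auto
  ultimately show ?thesis
    using alternating_triples_iff[of i j l n] alternating_triples_iff[of j l i n]
      alternating_triples_iff[of l i j n] a r
    unfolding arrow_def by auto
qed

text \<open>In the polygon picture for odd \<open>n\<close>: a triangle around the centre meets
  every half circle.\<close>

lemma out_nbrs_meets_alternating_triple:
  assumes i: "i \<in> {1..n}" and t: "t \<in> alternating_triples n"
  shows "t \<inter> out_nbrs n i \<noteq> {}"
proof -
  obtain p q r where pqr: "t = {p, q, r}" "1 \<le> p" "p < q" "q < r" "r \<le> n" "even p \<noteq> even q" "even q \<noteq> even r"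
    using t by (auto simp: alternating_triples_def)
  then have in_range: "p \<in> {1..n}" "q \<in> {1..n}" "r \<in> {1..n}" by auto
  have "arrow i p \<or> arrow i q \<or> arrow i r"
    using pqr(3,4,6,7) unfolding arrow_def by (cases i p rule: linorder_cases; cases i q rule: linorder_cases; cases i r rule: linorder_cases) auto
  then show ?thesis using in_range by (auto simp: pqr(1) out_nbrs_def)
qed

text \<open>The complement of a non-face contains no cyclic triangle, so the tournament is
  transitive there and has a sink. The out-neighbours of the sink all lie in
  \<open>M\<close>.\<close>

lemma nonface_alternating_iff:
  assumes M: "M \<subseteq> {1..n}" and n: "n \<ge> 1"
  shows "M \<notin> alternating_complex n \<longleftrightarrow> (\<exists>i\<in>{1..n}. out_nbrs n i \<subseteq> M)"
proof
  assume "\<exists>i\<in>{1..n}. out_nbrs n i \<subseteq> M"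
  then show "M \<notin> alternating_complex n"
    using out_nbrs_meets_alternating_triple unfolding alternating_complex_def by blast
next
  assume nf: "M \<notin> alternating_complex n"
  let ?C = "{1..n} - M"
  show "\<exists>i\<in>{1..n}. out_nbrs n i \<subseteq> M"
  proof (cases "?C = {}")
    case True
    then show ?thesis using n by (intro bexI[of _ 1]) (auto simp: out_nbrs_def)
  next
    case False
    \<comment> \<open>The sink is found as a vertex of least out-degree within the complement: by
      transitivity, an arrow from it to \<open>j\<close> would make the out-degree of
      \<open>j\<close> smaller still.\<close>
    define h where "h i = card (out_nbrs n i \<inter> ?C)" for i
    obtain i where i: "i \<in> ?C" "\<And>j. j \<in> ?C \<Longrightarrow> h i \<le> h j"
      using arg_min_if_finite[of ?C h] False not_less by (metis finite_Diff finite_atLeastAtMost)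
    have "out_nbrs n i \<inter> ?C = {}"
    proof (rule ccontr)
      assume "out_nbrs n i \<inter> ?C \<noteq> {}"
      then obtain j where j: "j \<in> out_nbrs n i" "j \<in> ?C" by blast
      have "out_nbrs n j \<inter> ?C \<subseteq> out_nbrs n i \<inter> ?C"
      proof
        fix w assume w: "w \<in> out_nbrs n j \<inter> ?C"
        have "\<not> arrow w i"
        proof
          assume "arrow w i"
          then have "{i, j, w} \<in> alternating_triples n"
            using cyclic_triangle[of i j w n] i(1) j w by (auto simp: out_nbrs_def)
          moreover have "{i, j, w} \<inter> M = {}" using i(1) j w by blast
          ultimately show False using nf M by (auto simp: alternating_complex_def)
        qed
        moreover have "w \<noteq> i" using w j arrow_linear[of i j] arrow_irrefl by (auto simp: out_nbrs_def)
        ultimately show "w \<in> out_nbrs n i \<inter> ?C"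
          using w arrow_linear[of i w] by (auto simp: out_nbrs_def)
      qed
      moreover have "j \<notin> out_nbrs n j" by (simp add: out_nbrs_def arrow_irrefl)
      ultimately have "out_nbrs n j \<inter> ?C \<subset> out_nbrs n i \<inter> ?C" using j by blast
      then have "h j < h i" unfolding h_def by (intro psubset_card_mono) auto
      then show False using i(2)[OF j(2)] by simp
    qed
    then have "out_nbrs n i \<subseteq> M" by (auto simp: out_nbrs_def)
    then show ?thesis using i(1) by blast
  qed
qed

text \<open>If there is an arrow from \<open>j\<close> to \<open>i\<close>, some path of length two
  leads back from \<open>i\<close> to \<open>j\<close>. Its middle vertex is an out-neighbour of
  \<open>i\<close> but not of \<open>j\<close>.\<close>

lemma out_nbrs_antichain:
  assumes i: "i \<in> {1..n}" "j \<in> {1..n}" "i \<noteq> j" and n: "odd n"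
  shows "\<not> out_nbrs n i \<subseteq> out_nbrs n j"
proof (cases "arrow i j")
  case True
  then have "j \<in> out_nbrs n i" using i by (simp add: out_nbrs_def)
  moreover have "j \<notin> out_nbrs n j" by (simp add: out_nbrs_def arrow_irrefl)
  ultimately show ?thesis by blast
next
  case False
  then have ji: "arrow j i" using arrow_linear i(3) by blast
  have "\<exists>w\<in>{1..n}. arrow i w \<and> arrow w j"
  proof (cases "i = n")
    case True
    \<comment> \<open>For \<open>i = n\<close> the successor is out of range. As \<open>n\<close> is
      odd, \<open>j\<close> is even, and \<open>j - 1\<close> serves as middle vertex.\<close>
    then have j: "even j" "j < n" using ji i n by (auto simp: arrow_def)
    then have "arrow n (j - 1)" "arrow (j - 1) j" "j - 1 \<in> {1..n}"
      using n i(2) by (auto simp: arrow_def elim!: evenE)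
    then show ?thesis using True by blast
  next
    case False
    have "arrow i (Suc i)" by (simp add: arrow_def)
    moreover have "arrow (Suc i) j" using ji unfolding arrow_def by (cases "j = Suc i") auto
    moreover have "Suc i \<in> {1..n}" using False i by simp
    ultimately show ?thesis by blast
  qed
  then obtain w where w: "w \<in> {1..n}" "arrow i w" "arrow w j" by blast
  then have "\<not> arrow j w" using arrow_linear[of j w] arrow_irrefl by metis
  then show ?thesis using w by (auto simp: out_nbrs_def)
qed

text \<open>The non-faces are the sets containing an out-neighbourhood, and the out-neighbourhoods
  form an antichain. The union is prescribed because \<open>minimal_nonfaces\<close> reads the
  vertices off the complex; for \<open>n = 3\<close> the only face is empty.\<close>

lemma minimal_nonfaces_alternating:
  assumes n: "odd n" and V: "\<Union>(alternating_complex n) = {1..n}"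
  shows "minimal_nonfaces (alternating_complex n) = out_nbrs n ` {1..n}"
proof -
  have n1: "n \<ge> 1" using n by (cases n) auto
  have iff: "M \<notin> alternating_complex n \<longleftrightarrow> (\<exists>i\<in>{1..n}. out_nbrs n i \<subseteq> M)" if "M \<subseteq> {1..n}" for M
    using nonface_alternating_iff[OF that n1] .
  show ?thesis
  proof (intro equalityI subsetI)
    fix M assume "M \<in> minimal_nonfaces (alternating_complex n)"
    then have M: "M \<subseteq> {1..n}" "M \<notin> alternating_complex n" "\<And>e. e \<in> M \<Longrightarrow> M - {e} \<in> alternating_complex n"
      by (auto simp: minimal_nonfaces_def V)
    then obtain i where i: "i \<in> {1..n}" "out_nbrs n i \<subseteq> M" using iff by blast
    have "e \<in> out_nbrs n i" if "e \<in> M" for e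
    proof (rule ccontr)
      assume "e \<notin> out_nbrs n i"
      then have "out_nbrs n i \<subseteq> M - {e}" using i(2) by blast
      then show False using iff[of "M - {e}"] M(1) M(3)[OF that] i(1) by blast
    qed
    then show "M \<in> out_nbrs n ` {1..n}" using i by blast
  next
    fix M assume "M \<in> out_nbrs n ` {1..n}"
    then obtain i where i: "i \<in> {1..n}" "M = out_nbrs n i" by blast
    have sub: "out_nbrs n i \<subseteq> {1..n}" by (auto simp: out_nbrs_def)
    have "out_nbrs n i - {e} \<in> alternating_complex n" if "e \<in> out_nbrs n i" for e
    proof (rule ccontr)
      assume "\<not> ?thesis"
      then obtain j where j: "j \<in> {1..n}" "out_nbrs n j \<subseteq> out_nbrs n i - {e}"
        using iff[of "out_nbrs n i - {e}"] sub by blast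
      then have "j = i" using out_nbrs_antichain[OF j(1) i(1) _ n] by blast
      then show False using j(2) that by blast
    qed
    then show "M \<in> minimal_nonfaces (alternating_complex n)"
      using iff[OF sub] sub i by (auto simp: minimal_nonfaces_def V)
  qed
qed

lemma card_minimal_nonfaces_alternating:
  assumes n: "odd n" and V: "\<Union>(alternating_complex n) = {1..n}"
  shows "card (minimal_nonfaces (alternating_complex n)) = n"
proof -
  have "inj_on (out_nbrs n) {1..n}"
    using out_nbrs_antichain[OF _ _ _ n] by (intro inj_onI) blast
  then show ?thesis unfolding minimal_nonfaces_alternating[OF assms] by (simp add: card_image)
qed

lemma minimal_nonfaces_image:
  assumes f: "inj_on f (\<Union>\<Delta>)"
  shows "minimal_nonfaces ((`) f ` \<Delta>) = (`) f ` minimal_nonfaces \<Delta>"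
proof -
  have iff: "f ` M \<in> (`) f ` \<Delta> \<longleftrightarrow> M \<in> \<Delta>" if "M \<subseteq> \<Union>\<Delta>" for M
    using inj_on_image_eq_iff[OF f that] by blast
  have U: "\<Union>((`) f ` \<Delta>) = f ` \<Union>\<Delta>" by blast
  have iff2: "f ` M \<in> minimal_nonfaces ((`) f ` \<Delta>) \<longleftrightarrow> M \<in> minimal_nonfaces \<Delta>" if M: "M \<subseteq> \<Union>\<Delta>" for M
  proof -
    have "f ` M - {f i} = f ` (M - {i})" if "i \<in> M" for i
      using inj_on_image_set_diff[OF f, of M "{i}"] M that by auto
    then have "(\<forall>i\<in>f ` M. f ` M - {i} \<in> (`) f ` \<Delta>) \<longleftrightarrow> (\<forall>i\<in>M. f ` (M - {i}) \<in> (`) f ` \<Delta>)" by simp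
    also have "\<dots> \<longleftrightarrow> (\<forall>i\<in>M. M - {i} \<in> \<Delta>)"
    proof -
      have "f ` (M - {i}) \<in> (`) f ` \<Delta> \<longleftrightarrow> M - {i} \<in> \<Delta>" for i using M by (intro iff) blast
      then show ?thesis by (simp only:)
    qed
    finally show ?thesis
      unfolding minimal_nonfaces_def mem_Collect_eq U iff[OF M] using M by blast
  qed
  show ?thesis
  proof (intro equalityI subsetI)
    fix N assume N: "N \<in> minimal_nonfaces ((`) f ` \<Delta>)"
    then have "N \<subseteq> f ` \<Union>\<Delta>" by (simp add: minimal_nonfaces_def U)
    then obtain M where "M \<subseteq> \<Union>\<Delta>" "N = f ` M" by (rule subset_imageE)
    then show "N \<in> (`) f ` minimal_nonfaces \<Delta>" using iff2 N by blast
  next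
    fix N assume "N \<in> (`) f ` minimal_nonfaces \<Delta>"
    then obtain M where "M \<in> minimal_nonfaces \<Delta>" "N = f ` M" by blast
    then show "N \<in> minimal_nonfaces ((`) f ` \<Delta>)" using iff2[of M] by (simp add: minimal_nonfaces_def)
  qed
qed

lemma card_minimal_nonfaces_image:
  assumes f: "inj_on f (\<Union>\<Delta>)"
  shows "card (minimal_nonfaces ((`) f ` \<Delta>)) = card (minimal_nonfaces \<Delta>)"
proof -
  have "inj_on ((`) f) (minimal_nonfaces \<Delta>)"
    using f by (intro inj_onI) (auto simp: minimal_nonfaces_def inj_on_image_eq_iff)
  then show ?thesis unfolding minimal_nonfaces_image[OF f] by (rule card_image)
qed


section \<open>Cyclic polytopes\<close>

lemma degree_prod_linear: "finite A \<Longrightarrow> degree (\<Prod>y\<in>A. [:- f y, 1:] :: real poly) = card A"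
  by (subst degree_prod_eq_sum_degree) auto

text \<open>\<open>L\<close> is Lagrange's interpolation polynomial and the sum is its coefficient
  of degree \<open>card S - 1\<close>. Interpolation reproduces \<open>g\<close>, whose degree is
  smaller.\<close>

lemma divided_difference_eq_0:
  fixes g :: "real poly"
  assumes S: "finite S" and g: "Suc (degree g) < card S"
  shows "(\<Sum>x\<in>S. poly g x / (\<Prod>y\<in>S - {x}. x - y)) = 0"
proof -
  define l where "l x = (\<Prod>y\<in>S - {x}. [:- y, 1:])" for x :: real
  define w where "w x = (\<Prod>y\<in>S - {x}. x - y)" for x
  define L where "L = (\<Sum>x\<in>S. smult (poly g x / w x) (l x))"
  have deg_l: "degree (l x) = card S - 1" if "x \<in> S" for x
    using that S degree_prod_linear[of "S - {x}" id] by (auto simp: l_def)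
  have "lead_coeff (l x) = 1" for x
    unfolding l_def lead_coeff_prod by simp
  then have coeff_l: "coeff (l x) (card S - 1) = 1" if "x \<in> S" for x
    using deg_l[OF that] by metis
  have w0: "w x \<noteq> 0" for x using S by (auto simp: w_def)
  have lx: "poly (l x) z = (if z = x then w x else 0)" if "z \<in> S" for x z
    using that S by (auto simp: l_def w_def poly_prod intro!: prod.cong)
  have "degree L \<le> card S - 1"
    unfolding L_def using S deg_l by (intro degree_sum_le) (auto intro: order_trans[OF degree_smult_le])
  then have "L = g"
    using g
  proof (intro poly_eqI_degree[of S])
    fix z assume z: "z \<in> S"
    have "poly L z = (\<Sum>x\<in>S. if z = x then poly g z else 0)"
      unfolding L_def poly_sum using lx[OF z] w0 by (intro sum.cong) auto
    then show "poly L z = poly g z" using S z by simp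
  qed auto
  then have "coeff L (card S - 1) = 0" using g by (simp add: coeff_eq_0)
  moreover have "coeff L (card S - 1) = (\<Sum>x\<in>S. poly g x / w x)"
    unfolding L_def coeff_sum by (intro sum.cong refl) (simp only: coeff_smult coeff_l mult_1_right)
  ultimately show ?thesis by (simp add: w_def)
qed

section \<open>The moment curve\<close>

lemma bij_betw_position: "bij_betw (\<lambda>j. card {..j}) (UNIV :: 'd::{finite,linorder} set) {1..CARD('d)}"
proof -
  have "inj (\<lambda>j::'d. card {..j})"
  proof (rule linorder_injI)
    fix j k :: 'd assume "j < k"
    then have "{..j} \<subset> {..k}" by auto
    then have "card {..j} < card {..k}" by (intro psubset_card_mono) auto
    then show "card {..j} \<noteq> card {..k}" by simp
  qed
  moreover have "card {..j} \<le> CARD('d)" for j :: 'd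
    by (rule card_mono) auto
  then have "range (\<lambda>j::'d. card {..j}) \<subseteq> {1..CARD('d)}"
    by (auto simp: Suc_le_eq card_gt_0_iff)
  ultimately show ?thesis
    unfolding bij_betw_def by (simp add: card_image card_subset_eq)
qed

lemma inner_moment_curve:
  "a \<bullet> moment_curve s = (\<Sum>j\<in>UNIV. a $ j * s ^ card {..j})" for a :: "real ^ 'd::{finite,linorder}"
  by (simp add: inner_vec_def moment_curve_def)

text \<open>Along the curve, affine functionals are the polynomials of degree at most the dimension.
  No coordinate has exponent 0, whence the separate constant.\<close>

lemma poly_eq_inner_moment_curve:
  fixes q :: "real poly"
  assumes "degree q \<le> CARD('d::{finite,linorder})"
  obtains a :: "real ^ 'd::{finite,linorder}" and c where "\<And>s. poly q s = a \<bullet> moment_curve s + c"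
proof
  fix s
  have "poly q s = (\<Sum>i\<le>CARD('d). coeff q i * s ^ i)"
    unfolding poly_altdef using assms by (intro sum.mono_neutral_left) (auto simp: coeff_eq_0)
  also have "{..CARD('d)} = insert 0 {1..CARD('d)}" by auto
  also have "(\<Sum>i\<in>insert 0 {1..CARD('d)}. coeff q i * s ^ i) = (\<Sum>i=1..CARD('d). coeff q i * s ^ i) + coeff q 0"
    by simp
  also have "(\<Sum>i=1..CARD('d). coeff q i * s ^ i) = (\<Sum>j\<in>UNIV. coeff q (card {..j::'d}) * s ^ card {..j})"
    using sum.reindex_bij_betw[OF bij_betw_position[where 'd='d], of "\<lambda>i. coeff q i * s ^ i"] by simp
  finally show "poly q s = (\<chi> j. coeff q (card {..j::'d})) \<bullet> moment_curve s + coeff q 0"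
    by (simp add: inner_moment_curve)
qed

text \<open>The form \<open>c - a \<bullet> moment_curve s\<close> makes a halfspace
  \<open>a \<bullet> x \<le> c\<close> containing the polytope a polynomial that is nonnegative at
  the parameters.\<close>

lemma inner_moment_curve_eq_poly:
  fixes a :: "real ^ 'd::{finite,linorder}"
  obtains q where "degree q \<le> CARD('d::{finite,linorder})" "\<And>s. poly q s = c - a \<bullet> moment_curve s"
proof
  let ?q = "[:c:] - (\<Sum>j\<in>UNIV. monom (a $ j) (card {..j}))"
  have "card {..j} \<le> CARD('d)" for j :: 'd by (intro card_mono) auto
  then show "degree ?q \<le> CARD('d)"
    by (intro degree_diff_le degree_sum_le) (auto intro: order_trans[OF degree_monom_le])
  show "poly ?q s = c - a \<bullet> moment_curve s" for s
    by (simp add: inner_moment_curve poly_sum poly_monom)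
qed

lemma inj_moment_curve: "inj (moment_curve :: real \<Rightarrow> real ^ 'd::{finite,linorder})"
proof (rule injI)
  fix s s' assume eq: "(moment_curve s :: (real, 'd) vec) = moment_curve s'"
  obtain a :: "(real, 'd) vec" and c where ac: "\<And>s. poly [:0, 1:] s = a \<bullet> moment_curve s + c"
    using poly_eq_inner_moment_curve[where 'd='d, of "[:0, 1:]"] by (auto simp: Suc_le_eq)
  show "s = s'" using ac[of s] ac[of s'] eq by simp
qed

text \<open>A polynomial vanishing on \<open>S\<close> except at \<open>x\<close> has small enough
  degree to be an affine functional. Applied to an affine dependence it isolates the coefficient at
  \<open>x\<close>.\<close>

lemma moment_curve_affine_independent:
  fixes S :: "real set"
  assumes S: "finite S" "card S \<le> Suc (CARD('d::{finite,linorder}))"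
  shows "\<not> affine_dependent (moment_curve ` S :: (real ^ 'd::{finite,linorder}) set)"
proof
  assume "affine_dependent (moment_curve ` S :: ((real, 'd) vec) set)"
  then obtain u :: "(real, 'd) vec \<Rightarrow> real" and v where u: "sum u (moment_curve ` S) = 0"
    and v: "v \<in> moment_curve ` S" "u v \<noteq> 0"
    and u1: "(\<Sum>v\<in>moment_curve ` S. u v *\<^sub>R v) = 0"
    using affine_dependent_explicit_finite[of "moment_curve ` S :: ((real, 'd) vec) set"] S by auto
  obtain x where x: "x \<in> S" "v = moment_curve x" using v(1) by blast
  define q where "q = (\<Prod>y\<in>S - {x}. [:- y, 1:])"
  have "degree q \<le> CARD('d)"
    using S x degree_prod_linear[of "S - {x}" id] by (simp add: q_def)
  then obtain a :: "(real, 'd) vec" and c where ac: "\<And>s. poly q s = a \<bullet> moment_curve s + c"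
    using poly_eq_inner_moment_curve by blast
  have inj: "inj_on moment_curve S" using inj_moment_curve by (rule inj_on_subset) simp
  have "0 = a \<bullet> (\<Sum>v\<in>moment_curve ` S. u v *\<^sub>R v) + c * sum u (moment_curve ` S)"
    using u u1 by simp
  also have "\<dots> = (\<Sum>s\<in>S. u (moment_curve s) * poly q s)"
    unfolding ac by (simp add: sum.reindex[OF inj] inner_sum_right sum_distrib_left sum.distrib[symmetric] algebra_simps)
  also have "\<dots> = (\<Sum>s\<in>S. if s = x then u v * poly q x else 0)"
    using S x by (intro sum.cong) (auto simp: q_def poly_prod)
  also have "\<dots> = u v * poly q x" using S x by simp
  finally have "poly q x = 0" using v by simp
  then show False using S by (auto simp: q_def poly_prod)
qed

section \<open>Sign patterns and Gale's evenness condition\<close>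

lemma sign_prod_differences:
  fixes t :: "nat \<Rightarrow> real"
  assumes "strict_mono_on A t" "i \<in> A" "J \<subseteq> A - {i}" "finite J"
  shows "(-1) ^ card {j\<in>J. i < j} * (\<Prod>j\<in>J. t i - t j) > 0"
  using assms(4,3)
proof (induction J)
  case (insert j J)
  have j: "j \<in> A" "j \<noteq> i" using insert.prems by auto
  have IH: "(-1) ^ card {j\<in>J. i < j} * (\<Prod>j\<in>J. t i - t j) > 0" using insert by simp
  show ?case
  proof (cases "i < j")
    case True
    then have "{k\<in>insert j J. i < k} = insert j {k\<in>J. i < k}" by auto
    then have "(-1) ^ card {k\<in>insert j J. i < k} * (\<Prod>j\<in>insert j J. t i - t j) =
        (t j - t i) * ((-1) ^ card {j\<in>J. i < j} * (\<Prod>j\<in>J. t i - t j))"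
      using insert.hyps by (simp add: algebra_simps)
    moreover have "t i < t j" using strict_mono_onD[OF assms(1,2) j(1)] True by simp
    ultimately show ?thesis using IH by simp
  next
    case False
    then have "{k\<in>insert j J. i < k} = {k\<in>J. i < k}" by auto
    then have "(-1) ^ card {k\<in>insert j J. i < k} * (\<Prod>j\<in>insert j J. t i - t j) =
        (t i - t j) * ((-1) ^ card {j\<in>J. i < j} * (\<Prod>j\<in>J. t i - t j))"
      using insert.hyps by (simp add: algebra_simps)
    moreover have "t j < t i" using strict_mono_onD[OF assms(1) j(1) assms(2)] False j(2) by simp
    ultimately show ?thesis using IH by simp
  qed
qed simp

text \<open>If \<open>C\<close> contains no alternating triple, parity changes at most once along \<open>C\<close>, and a
  linear polynomial changing sign there realises the sign pattern \<open>(-1)^i\<close> on \<open>C\<close>.\<close>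

lemma linear_with_alternating_signs:
  fixes t :: "nat \<Rightarrow> real"
  assumes t: "strict_mono_on {1..n} t" and C: "C \<subseteq> {1..n}"
    and no: "\<And>\<tau>. \<tau> \<in> alternating_triples n \<Longrightarrow> \<not> \<tau> \<subseteq> C"
  obtains r \<sigma> where "degree r \<le> 1" "\<And>i. i \<in> C \<Longrightarrow> \<sigma> * (-1) ^ i * poly r (t i) > 0"
proof (cases "\<exists>i\<in>C. \<exists>j\<in>C. even i \<noteq> even j")
  case False
  then consider "\<forall>i\<in>C. even i" | "\<forall>i\<in>C. odd i" by blast
  then show ?thesis
  proof cases
    case 1
    then show ?thesis using that[of 1 1] by simp
  next
    case 2
    then show ?thesis using that[of 1 "-1"] by simp
  qed
next
  case True
  have finC: "finite C" using C finite_subset by blast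
  define m where "m = Min C"
  define D where "D = {i\<in>C. even i \<noteq> even m}"
  define c where "c = Min D"
  have m: "m \<in> C" "\<And>i. i \<in> C \<Longrightarrow> m \<le> i"
    using True Min_in[OF finC] Min_le[OF finC] unfolding m_def by blast+
  have "D \<noteq> {}" "finite D" using True finC by (auto simp: D_def)
  then have c: "c \<in> D" "\<And>i. i \<in> D \<Longrightarrow> c \<le> i" by (auto simp: c_def)
  have cC: "c \<in> C" "even c \<noteq> even m" using c by (auto simp: D_def)
  have mc: "m < c" using m cC by (metis le_neq_implies_less)
  have below: "even i = even m" if "i \<in> C" "i < c" for i
    using that c(2)[of i] by (auto simp: D_def)
  have above: "even i = even c" if i: "i \<in> C" "c \<le> i" for i
  proof (rule ccontr)
    assume p: "even i \<noteq> even c"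
    then have "c < i" using i by (metis le_neq_implies_less)
    then have "{m, c, i} \<in> alternating_triples n"
      using alternating_triples_iff[OF mc, of i n] p cC m(1) i C by auto
    then show False using no[of "{m, c, i}"] m(1) cC(1) i(1) by simp
  qed
  \<comment> \<open>The index \<open>c - 1\<close> need not belong to \<open>C\<close>, but it is at
    least 1 since \<open>m < c\<close>, and it bounds all elements of \<open>C\<close> below
    \<open>c\<close>. The zero \<open>z\<close> thus separates the two parities.\<close>
  define z where "z = (t (c - 1) + t c) / 2"
  have r: "1 \<le> c - 1" "c \<le> n" using mc subsetD[OF C m(1)] subsetD[OF C cC(1)] by auto
  have "t (c - 1) < t c" using r by (intro strict_mono_onD[OF t]) auto
  then have z: "t (c - 1) < z" "z < t c" by (auto simp: z_def)
  show ?thesis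
  proof (rule that[of "[:- z, 1:]" "(-1) ^ c"])
    fix i assume i: "i \<in> C"
    show "(-1) ^ c * (-1) ^ i * poly [:- z, 1:] (t i) > 0"
    proof (cases "i < c")
      case True
      then have "t i \<le> t (c - 1)" using i C r
        by (intro strict_mono_on_leD[OF t]) auto
      moreover have "odd (c + i)" using below[OF i True] cC(2) by auto
      then have "(-1 :: real) ^ c * (-1) ^ i = -1" unfolding power_add[symmetric] by simp
      ultimately show ?thesis using z by simp
    next
      case False
      then have "t c \<le> t i" using i C r by (intro strict_mono_on_leD[OF t]) auto
      moreover have "even (c + i)" using above[OF i] False by auto
      then have "(-1 :: real) ^ c * (-1) ^ i = 1" unfolding power_add[symmetric] by simp
      ultimately show ?thesis using z by simp
    qed
  qed simp
qed

text \<open>A linear factor \<open>r\<close> keeps the degree at most \<open>n - 2\<close>, so the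
  divided difference of \<open>q * r\<close> over all \<open>n\<close> parameters vanishes. The
  denominators \<open>w i\<close> alternate in sign with \<open>i\<close>, and so does
  \<open>r\<close> on the support of \<open>q\<close>; all nonzero terms then have the same
  sign.\<close>

lemma zero_set_in_alternating_complex:
  fixes t :: "nat \<Rightarrow> real" and q :: "real poly"
  assumes t: "strict_mono_on {1..n} t" and deg: "degree q + 3 \<le> n"
    and nonneg: "\<And>i. i \<in> {1..n} \<Longrightarrow> 0 \<le> poly q (t i)" and "\<exists>i\<in>{1..n}. poly q (t i) \<noteq> 0"
  shows "{i\<in>{1..n}. poly q (t i) = 0} \<in> alternating_complex n"
proof (rule ccontr)
  assume nf: "\<not> ?thesis"
  let ?I = "{1..n}"
  define C where "C = {i\<in>?I. poly q (t i) \<noteq> 0}"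
  have C: "C \<subseteq> ?I" "C \<noteq> {}" "finite C" using assms(4) by (auto simp: C_def)
  have "\<not> \<tau> \<subseteq> C" if "\<tau> \<in> alternating_triples n" for \<tau>
    using nf that by (auto simp: alternating_complex_def C_def)
  then obtain r \<sigma> where r: "degree r \<le> 1" "\<And>i. i \<in> C \<Longrightarrow> \<sigma> * (-1) ^ i * poly r (t i) > 0"
    using linear_with_alternating_signs[OF t C(1)] by metis
  define w where "w i = (\<Prod>j\<in>?I - {i}. t i - t j)" for i
  have inj: "inj_on t ?I" using t by (rule strict_mono_on_imp_inj_on)
  have w: "(-1) ^ n * (-1) ^ i * w i > 0" if "i \<in> ?I" for i
  proof -
    have "{j\<in>?I - {i}. i < j} = {i<..n}" using that by auto
    then have "(-1) ^ (n - i) * w i > 0"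
      using sign_prod_differences[OF t that, of "?I - {i}"] by (simp add: w_def)
    moreover have "(-1 :: real) ^ (n - i) = (-1) ^ n * (-1) ^ i"
      using that by (auto simp: minus_one_power_iff)
    ultimately show ?thesis by simp
  qed
  have "Suc (degree (q * r)) < card (t ` ?I)"
    using degree_mult_le[of q r] r(1) deg card_image[OF inj] by simp
  then have "0 = (\<Sum>x\<in>t ` ?I. poly (q * r) x / (\<Prod>y\<in>t ` ?I - {x}. x - y))"
    using divided_difference_eq_0[of "t ` ?I" "q * r"] by simp
  also have "\<dots> = (\<Sum>i\<in>?I. poly (q * r) (t i) / w i)"
    unfolding sum.reindex[OF inj] comp_def
  proof (intro sum.cong refl)
    fix i assume i: "i \<in> ?I"
    have "t ` ?I - {t i} = t ` (?I - {i})" using inj_on_image_set_diff[OF inj, of ?I "{i}"] i by simp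
    then have "(\<Prod>y\<in>t ` ?I - {t i}. t i - y) = w i"
      using prod.reindex[OF inj_on_subset[OF inj], of "?I - {i}"] by (simp add: w_def)
    then show "poly (q * r) (t i) / (\<Prod>y\<in>t ` ?I - {t i}. t i - y) = poly (q * r) (t i) / w i" by simp
  qed
  also have "\<dots> = (\<Sum>i\<in>C. poly (q * r) (t i) / w i)"
    by (intro sum.mono_neutral_right) (auto simp: C_def)
  finally have "(\<Sum>i\<in>C. \<sigma> * (-1) ^ n * (poly (q * r) (t i) / w i)) = 0"
    unfolding sum_distrib_left[symmetric] by simp
  moreover have "(\<Sum>i\<in>C. \<sigma> * (-1) ^ n * (poly (q * r) (t i) / w i)) > 0"
  proof (rule sum_pos[OF C(3,2)])
    fix i assume i: "i \<in> C"
    then have iI: "i \<in> ?I" and q: "0 < poly q (t i)" using nonneg[of i] by (auto simp: C_def less_le)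
    have "\<sigma> * (-1) ^ n * (poly (q * r) (t i) / w i) =
        (\<sigma> * (-1) ^ i * poly r (t i)) * poly q (t i) / ((-1) ^ n * (-1) ^ i * w i)"
      by (cases "even n"; cases "even i") (auto simp: field_simps)
    also have "\<dots> > 0" by (intro divide_pos_pos mult_pos_pos[OF _ q] r(2)[OF i] w[OF iI])
    finally show "0 < \<sigma> * (-1) ^ n * (poly (q * r) (t i) / w i)" .
  qed
  ultimately show False by simp
qed

text \<open>At an index in \<open>\<tau>\<close> the sign of the product depends on the number of
  zeros above it. Alternating parities make the three numbers congruent to \<open>n - c\<close>
  modulo 2, so a single factor \<open>(-1) ^ (n - c)\<close> corrects all signs.\<close>

lemma supporting_poly:
  fixes t :: "nat \<Rightarrow> real"
  assumes t: "strict_mono_on {1..n} t" and \<tau>: "\<tau> \<in> alternating_triples n"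
  obtains q where "degree q + 3 = n" "\<And>i. i \<in> {1..n} \<Longrightarrow> 0 \<le> poly q (t i)"
    "\<And>i. i \<in> {1..n} \<Longrightarrow> poly q (t i) = 0 \<longleftrightarrow> i \<notin> \<tau>"
proof -
  obtain a b c where abc: "\<tau> = {a, b, c}" "1 \<le> a" "a < b" "b < c" "c \<le> n" "even a \<noteq> even b" "even b \<noteq> even c"
    using \<tau> by (auto simp: alternating_triples_def)
  let ?F = "{1..n} - \<tau>"
  have \<tau>I: "\<tau> \<subseteq> {1..n}" "card \<tau> = 3" using abc by auto
  then have "card ?F = n - 3" by (subst card_Diff_subset) (auto intro: finite_subset)
  moreover have "3 \<le> n" using abc by linarith
  ultimately have cF: "card ?F + 3 = n" by simp
  define q where "q = smult ((-1) ^ (n - c)) (\<Prod>j\<in>?F. [:- t j, 1:])"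
  have deg: "degree q + 3 = n" using cF degree_prod_linear[of ?F t] by (simp add: q_def)
  have pq: "poly q s = (-1) ^ (n - c) * (\<Prod>j\<in>?F. s - t j)" for s by (simp add: q_def poly_prod)
  have zero: "poly q (t i) = 0" if "i \<in> {1..n}" "i \<notin> \<tau>" for i
    using that by (auto simp: pq)
  have pos: "poly q (t i) > 0" if i: "i \<in> \<tau>" for i
  proof -
    have iI: "i \<in> {1..n}" using i \<tau>I by blast
    have "{j\<in>?F. i < j} = {i<..n} - {j\<in>\<tau>. i < j}" using iI by auto
    moreover have "{j\<in>\<tau>. i < j} \<subseteq> {i<..n}" using \<tau>I by auto
    ultimately have "card {j\<in>?F. i < j} = n - i - card {j\<in>\<tau>. i < j}"
      by (simp add: card_Diff_subset finite_subset)
    moreover have "card {j\<in>\<tau>. i < j} = (if i = a then 2 else if i = b then 1 else 0)"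
    proof -
      have "{j\<in>\<tau>. i < j} = (if i = a then {b, c} else if i = b then {c} else {})"
        using i abc by auto
      then show ?thesis using abc by auto
    qed
    ultimately have "even (card {j\<in>?F. i < j}) \<longleftrightarrow> even (n - c)"
      using i abc by (auto split: if_splits)
    then have "(-1 :: real) ^ (n - c) = (-1) ^ card {j\<in>?F. i < j}"
      by (cases "even (n - c)") simp_all
    moreover have "0 < (-1) ^ card {j\<in>?F. i < j} * (\<Prod>j\<in>?F. t i - t j)"
      by (rule sign_prod_differences[OF t iI]) (use i in auto)
    ultimately show ?thesis unfolding pq by metis
  qed
  show ?thesis
    using that[OF deg] zero pos by (metis less_eq_real_def less_irrefl)
qed

lemma boundary_complex_cyclic_polytope:
  fixes t :: "nat \<Rightarrow> real"
  assumes t: "strict_mono_on {1..n} t" and n: "n = CARD('d::{finite,linorder}) + 3"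
  defines "p \<equiv> (\<lambda>i. moment_curve (t i) :: real ^ 'd::{finite,linorder})"
  shows "boundary_complex (cyclic_polytope n t :: (real ^ 'd::{finite,linorder}) set) = (`) p ` alternating_complex n"
    and "inj_on p {1..n}"
proof -
  let ?I = "{1..n}"
  let ?P = "cyclic_polytope n t :: ((real, 'd) vec) set"
  have P: "?P = convex hull (p ` ?I)" by (simp add: cyclic_polytope_def p_def)
  have polyP: "polyhedron ?P" "convex ?P" "compact (p ` ?I)"
    unfolding P by (auto intro: polytope_imp_polyhedron polytope_convex_hull finite_imp_compact)
  have pP: "p i \<in> ?P" if "i \<in> ?I" for i using that by (auto simp: P intro: hull_inc)
  have injt: "inj_on t ?I" using t by (rule strict_mono_on_imp_inj_on)
  show inj: "inj_on p ?I"
    unfolding p_def by (intro inj_onI) (erule inj_onD[OF injt injD[OF inj_moment_curve]])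
  show "boundary_complex ?P = (`) p ` alternating_complex n"
  proof (intro equalityI subsetI)
    fix X assume "X \<in> boundary_complex ?P"
    then obtain G where X: "X = {x. x extreme_point_of G}" and G: "G face_of ?P" "G \<noteq> ?P"
      by (auto simp: boundary_complex_def)
    \<comment> \<open>Faces of polyhedra are exposed, so any proper face, of whatever dimension,
      yields a polynomial that is nonnegative at the parameters and vanishes at those of its
      vertices.\<close>
    have "G exposed_face_of ?P" using G(1) exposed_face_of_polyhedron[OF polyP(1)] by simp
    then obtain a b where ab: "?P \<subseteq> {x. a \<bullet> x \<le> b}" "G = ?P \<inter> {x. a \<bullet> x = b}"
      unfolding exposed_face_of_def by blast
    obtain q where q: "degree q \<le> CARD('d)" "\<And>s. poly q s = b - a \<bullet> moment_curve s"
      using inner_moment_curve_eq_poly by blast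
    have qi: "poly q (t i) = b - a \<bullet> p i" for i by (simp add: q(2) p_def)
    have "\<exists>i\<in>?I. poly q (t i) \<noteq> 0"
    proof (rule ccontr)
      assume "\<not> ?thesis"
      then have "p ` ?I \<subseteq> {x. a \<bullet> x = b}" by (auto simp: qi)
      then have "?P \<subseteq> {x. a \<bullet> x = b}" unfolding P by (intro hull_minimal convex_hyperplane)
      then show False using G(2) ab(2) by blast
    qed
    moreover have "0 \<le> poly q (t i)" if "i \<in> ?I" for i using pP[OF that] ab(1) by (auto simp: qi)
    ultimately have Z: "{i\<in>?I. poly q (t i) = 0} \<in> alternating_complex n"
      using q(1) n by (intro zero_set_in_alternating_complex[OF t]) auto
    define S where "S = {i\<in>?I. p i \<in> X}"
    have "X \<subseteq> G" by (auto simp: X extreme_point_of_def)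
    then have "S \<subseteq> {i\<in>?I. poly q (t i) = 0}" using ab(2) by (auto simp: S_def qi)
    then have "S \<in> alternating_complex n" using Z by (auto simp: alternating_complex_def)
    moreover have "X \<subseteq> p ` ?I"
    proof
      fix x assume "x \<in> X"
      then have "x extreme_point_of ?P" using extreme_point_of_face[OF G(1)] by (simp add: X)
      then show "x \<in> p ` ?I" unfolding P by (rule extreme_point_of_convex_hull)
    qed
    then have "X = p ` S" by (auto simp: S_def)
    ultimately show "X \<in> (`) p ` alternating_complex n" by blast
  next
    fix X assume "X \<in> (`) p ` alternating_complex n"
    then obtain S \<tau> where S: "X = p ` S" "S \<subseteq> ?I" and \<tau>: "\<tau> \<in> alternating_triples n" "\<tau> \<inter> S = {}"
      by (auto simp: alternating_complex_def)
    let ?F = "?I - \<tau>"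
    obtain q where q: "degree q + 3 = n" "\<And>i. i \<in> ?I \<Longrightarrow> 0 \<le> poly q (t i)"
      "\<And>i. i \<in> ?I \<Longrightarrow> poly q (t i) = 0 \<longleftrightarrow> i \<notin> \<tau>"
      using supporting_poly[OF t \<tau>(1)] by metis
    obtain a :: "(real, 'd) vec" and c where "\<And>s. poly q s = a \<bullet> moment_curve s + c"
      using poly_eq_inner_moment_curve[where 'd='d, of q] q(1) n by auto
    then have qi: "poly q (t i) = a \<bullet> p i + c" for i by (simp add: p_def)
    define G where "G = ?P \<inter> {x. a \<bullet> x = - c}"
    have "p ` ?I \<subseteq> {x. a \<bullet> x \<ge> - c}" using q(2) by (fastforce simp: qi)
    then have "?P \<subseteq> {x. a \<bullet> x \<ge> - c}" unfolding P by (intro hull_minimal convex_halfspace_ge)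
    then have G: "G face_of ?P"
      unfolding G_def by (intro face_of_Int_supporting_hyperplane_ge polyP(2)) auto
    have pG: "p i \<in> G \<longleftrightarrow> i \<notin> \<tau>" if "i \<in> ?I" for i
      using q(3)[OF that] pP[OF that] by (auto simp: G_def qi)
    \<comment> \<open>A face of a convex hull is the hull of some of the generators, and the
      generators in \<open>G\<close> are those with index outside \<open>\<tau>\<close>.\<close>
    have GF: "G = convex hull (p ` ?F)"
    proof
      obtain Y where Y: "Y \<subseteq> p ` ?I" "G = convex hull Y"
        using face_of_convex_hull_subset[OF polyP(3)] G unfolding P by metis
      then have "Y \<subseteq> G" by (auto intro: hull_inc)
      then have "Y \<subseteq> p ` ?F" using Y(1) pG by blast
      then show "G \<subseteq> convex hull (p ` ?F)" unfolding Y(2) by (rule hull_mono)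
      show "convex hull (p ` ?F) \<subseteq> G"
        using pG face_of_imp_convex[OF G] by (intro hull_minimal) auto
    qed
    obtain i0 where i0: "i0 \<in> \<tau>" "i0 \<in> ?I" using \<tau>(1) by (fastforce simp: alternating_triples_def)
    have indep: "\<not> affine_dependent (p ` ?F)"
    proof -
      obtain i j l where "\<tau> = {i, j, l}" "1 \<le> i" "i < j" "j < l" "l \<le> n"
        using \<tau>(1) by (auto simp: alternating_triples_def)
      then have "\<tau> \<subseteq> ?I" "card \<tau> = 3" "finite \<tau>" by auto
      then have "card ?F = CARD('d)" using n by (simp add: card_Diff_subset)
      then have "card (t ` ?F) \<le> Suc CARD('d)" using card_image_le[of ?F t] by simp
      then show ?thesis
        using moment_curve_affine_independent[of "t ` ?F", where 'd='d] by (simp add: p_def image_image)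
    qed
    have SF: "p ` S \<subseteq> p ` ?F" using S(2) \<tau>(2) by blast
    \<comment> \<open>\<open>G\<close> is a simplex, so every subset of its vertices spans a
      face.\<close>
    then have face: "convex hull (p ` S) face_of G"
      unfolding GF using face_of_convex_hull_affine_independent[OF indep] by blast
    then have "convex hull (p ` S) face_of ?P" using G face_of_trans by blast
    moreover have "convex hull (p ` S) \<noteq> ?P"
      using face_of_imp_subset[OF face] pG[OF i0(2)] i0 pP[OF i0(2)] by blast
    moreover have "\<not> affine_dependent (p ` S)" using indep SF affine_independent_subset by blast
    then have "X = {x. x extreme_point_of convex hull (p ` S)}"
      using extreme_point_of_convex_hull_affine_independent S(1) by blast
    ultimately show "X \<in> boundary_complex ?P" unfolding boundary_complex_def by blast
  qed
qed


theorem proposition5p2: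
  fixes \<Delta> :: "nat set set" and n d m :: nat
  assumes "homology_sphere TYPE('k::field) d {1..n} \<Delta>"
    and "unsuspended \<Delta>"
    and "m = card (minimal_nonfaces \<Delta>)"
    and "n - d = 3"
    and "d = CARD('d::{finite,linorder})"
  shows "odd m \<and> n = m \<and> m \<ge> 5 \<and>
    (\<forall>t. strict_mono_on {1..n} t \<longrightarrow>
      complex_iso \<Delta> (boundary_complex (cyclic_polytope n t :: (real ^ 'd::{finite,linorder}) set)))"
proof -
  let ?V = "{1..n}"
  define T where "T = cofacets ?V \<Delta>"
  note sphere = assms(1)
  \<comment> \<open>The difference of natural numbers is positive, so it is not truncated.\<close>
  have n: "card ?V = d + 3" "n = d + 3" using assms(4) by simp_all
  have \<Delta>: "complex_on ?V \<Delta>" using sphere_complex[OF sphere] .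
  have U: "\<Union>\<Delta> = ?V" using complex_on_Union[OF \<Delta>] .
  have face: "S \<in> \<Delta> \<longleftrightarrow> S \<subseteq> ?V \<and> (\<exists>t\<in>T. t \<inter> S = {})" for S
    unfolding T_def by (rule sphere_face_iff[OF sphere n(1)])
  have T: "t \<subseteq> ?V" "card t = 3" if "t \<in> T" for t
    using that by (auto simp: T_def cofacets_def)
  interpret triple_system ?V T
  proof
    show "T \<noteq> {}" using face[of "{}"] \<Delta> by (auto simp: complex_on_def)
  next
    fix a b c e assume "{a, b, c} \<in> T" "e \<in> ?V" "e \<notin> {a, b, c}"
    then show "{b, c, e} \<in> T \<and> {a, c, e} \<notin> T \<and> {a, b, e} \<notin> T \<or>
      {b, c, e} \<notin> T \<and> {a, c, e} \<in> T \<and> {a, b, e} \<notin> T \<or>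
      {b, c, e} \<notin> T \<and> {a, c, e} \<notin> T \<and> {a, b, e} \<in> T"
      unfolding T_def by (rule cofacet_exchange[OF sphere n(1)])
  next
    fix x y0 y1 y2 y3 y4
    assume "distinct [x, y0, y1, y2, y3, y4]" "{x, y0, y1, y2, y3, y4} \<subseteq> ?V"
      "{x, y0, y1} \<in> T" "{x, y1, y2} \<in> T" "{x, y2, y3} \<in> T" "{x, y3, y4} \<in> T" "{x, y4, y0} \<in> T"
      "{y0, y1, y3} \<in> T" "{y1, y2, y4} \<in> T" "{y2, y3, y0} \<in> T" "{y3, y4, y1} \<in> T" "{y4, y0, y2} \<in> T"
    then show False unfolding T_def by (rule no_projective_plane[OF sphere n(1)])
  next
    fix u v
    assume uv: "u \<in> ?V" "v \<in> ?V" "u \<noteq> v" and both: "\<forall>t\<in>T. \<not> {u, v} \<subseteq> t"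
      and swap: "\<forall>t\<in>T. u \<in> t \<longrightarrow> insert v (t - {u}) \<in> T" "\<forall>t\<in>T. v \<in> t \<longrightarrow> insert u (t - {v}) \<in> T"
    \<comment> \<open>If the complement \<open>t\<close> of a facet around \<open>S\<close> contains
      \<open>a\<close>, exchanging \<open>a\<close> for \<open>b\<close> in \<open>t\<close> gives
      the complement of a facet around \<open>insert a S\<close>.\<close>
    have ins: "insert a S \<in> \<Delta>"
      if ab: "a \<in> ?V" "a \<noteq> b" "\<forall>t\<in>T. \<not> {a, b} \<subseteq> t" "\<forall>t\<in>T. a \<in> t \<longrightarrow> insert b (t - {a}) \<in> T"
        and S: "S \<in> \<Delta>" "b \<notin> S" for a b S
    proof -
      obtain t where t: "t \<in> T" "t \<inter> S = {}" "S \<subseteq> ?V" using S(1) face[of S] by blast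
      have "\<exists>t'\<in>T. t' \<inter> insert a S = {}"
      proof (cases "a \<in> t")
        case True
        then have "insert b (t - {a}) \<in> T" using ab(4) t(1) by blast
        moreover have "insert b (t - {a}) \<inter> insert a S = {}" using t(2) S(2) ab(2) by blast
        ultimately show ?thesis by blast
      qed (use t in blast)
      then show ?thesis using t(3) ab(1) by (simp add: face)
    qed
    have both': "\<forall>t\<in>T. \<not> {v, u} \<subseteq> t" using both by blast
    have "insert u S \<in> \<Delta> \<and> insert v S \<in> \<Delta>" if "S \<in> \<Delta>" "u \<notin> S" "v \<notin> S" for S
      using ins[OF uv(1,3) both swap(1) that(1,3)]
        ins[OF uv(2) uv(3)[symmetric] both' swap(2) that(1,2)] by simp
    then have "\<not> unsuspended \<Delta>" using suspended_if_twins[OF \<Delta> uv(2,3)] by blast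
    then show False using assms(2) by simp
  qed (use T in auto)
  obtain f where odd: "odd n" and f: "bij_betw f ?V {1..n}"
    and T_iff: "\<And>t. t \<subseteq> ?V \<Longrightarrow> t \<in> T \<longleftrightarrow> f ` t \<in> alternating_triples n"
    using numbering by auto
  have inj: "inj_on f ?V" and surj: "f ` ?V = {1..n}" using f by (auto simp: bij_betw_def)
  have face_iff: "S \<in> \<Delta> \<longleftrightarrow> f ` S \<in> alternating_complex n" if S: "S \<subseteq> ?V" for S
  proof
    assume "S \<in> \<Delta>"
    then obtain t where t: "t \<in> T" "t \<inter> S = {}" using face by blast
    then have "f ` t \<inter> f ` S = {}" using inj_on_image_Int[OF inj T(1)[OF t(1)] S] by simp
    moreover have "f ` t \<in> alternating_triples n" using T_iff T(1) t(1) by blast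
    ultimately show "f ` S \<in> alternating_complex n"
      using S surj unfolding alternating_complex_def by blast
  next
    assume "f ` S \<in> alternating_complex n"
    then obtain \<tau> where \<tau>: "\<tau> \<in> alternating_triples n" "\<tau> \<inter> f ` S = {}"
      by (auto simp: alternating_complex_def)
    have "\<tau> \<subseteq> f ` ?V" unfolding surj using \<tau>(1) by (auto simp: alternating_triples_def)
    then obtain t where t: "t \<subseteq> ?V" "\<tau> = f ` t" by (rule subset_imageE)
    then have "t \<in> T" "t \<inter> S = {}" using T_iff \<tau> by blast+
    then show "S \<in> \<Delta>" using face S by blast
  qed
  have image: "(`) f ` \<Delta> = alternating_complex n"
  proof (intro equalityI subsetI)
    fix X assume "X \<in> (`) f ` \<Delta>"
    then show "X \<in> alternating_complex n" using face_iff complex_on_face_subset[OF \<Delta>] by blast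
  next
    fix X assume X: "X \<in> alternating_complex n"
    then have "X \<subseteq> f ` ?V" unfolding surj by (simp add: alternating_complex_def)
    then obtain S where "S \<subseteq> ?V" "X = f ` S" by (rule subset_imageE)
    then show "X \<in> (`) f ` \<Delta>" using face_iff X by blast
  qed
  \<comment> \<open>The vertex condition for counting minimal non-faces is inherited from
    \<open>\<Delta>\<close>, in which every vertex is a face.\<close>
  have "\<Union>(alternating_complex n) = f ` \<Union>\<Delta>" unfolding image[symmetric] by blast
  then have "\<Union>(alternating_complex n) = {1..n}" using U surj by simp
  then have m: "m = n"
    using card_minimal_nonfaces_image[of f \<Delta>] card_minimal_nonfaces_alternating[OF odd] inj
    by (simp add: U image assms(3))
  \<comment> \<open>\<open>d \<ge> 1\<close> gives only \<open>n \<ge> 4\<close>; parity excludes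
    the remaining value.\<close>
  have "n \<noteq> 4" using odd by auto
  then have "n \<ge> 5" using n(2) sphere_dim_pos[OF sphere] by linarith
  moreover have "complex_iso \<Delta> (boundary_complex (cyclic_polytope n t :: (real, 'd) vec set))"
    if t: "strict_mono_on {1..n} t" for t
  proof -
    let ?p = "\<lambda>i. moment_curve (t i) :: (real, 'd) vec"
    have nd: "n = CARD('d) + 3" using n(2) assms(5) by simp
    have "inj_on (?p \<circ> f) (\<Union>\<Delta>)"
      using boundary_complex_cyclic_polytope(2)[OF t nd] inj surj by (simp add: U comp_inj_on)
    then have "complex_iso \<Delta> ((`) (?p \<circ> f) ` \<Delta>)" by (rule complex_iso_image)
    moreover have "(`) (?p \<circ> f) ` \<Delta> = (`) ?p ` (`) f ` \<Delta>" by (simp add: image_image image_comp comp_def)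
    ultimately show ?thesis
      using boundary_complex_cyclic_polytope(1)[OF t nd] image by simp
  qed
  ultimately show ?thesis using m odd by simp
qed

end
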